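(* Let $\mathcal{G}=(X,Y,A,B,\lambda)$ be an imitation game with $|X|=|A|=2$, and let $p\in\mathcal{C}_{qa}(\mathcal{G})$. Let $\varphi$ be a state on $\mathcal{A}(X,A)\otimes_{\min}\mathcal{A}(Y,B)$ such that $\varphi(e_a^x\otimes f_b^y)=p(a,b\mid x,y)$ for all $x\in X$, $y\in Y$, $a\in A$, $b\in B$ (such a state exists because $p\in\mathcal{C}_{qa}(\mathcal{G})$). Let $\mathcal{H}$, the unit vector $|\psi\rangle\in\mathcal{H}$ and the $*$-representation $$\pi:\mathcal{A}(X,A)\otimes_{\min}\mathcal{A}(Y,B)\to\mathcal{B}(\mathcal{H})$$ be the Hilbert space, cyclic vector and representation produced by the GNS construction of $\varphi$, so that $\varphi(c)=\langle\psi|\pi(c)|\psi\rangle$ for all $c\in\mathcal{A}(X,A)\otimes_{\min}\mathcal{A}(Y,B)$. Suppose that the restrictions $\pi_1:=\pi|_{\mathcal{A}(X,A)\otimes\mathbf{1}}$ and $\pi_2:=\pi|_{\mathbf{1}\otimes\mathcal{A}(Y,B)}$ are injective. Then there exist a von Neumann algebra $\mathcal{U}$, a $*$-homomorphism $\rho:\mathbb{C}\langle X,A\rangle\otimes_{\mathrm{alg}}\mathbb{C}\langle Y,B\rangle\to\mathcal{U}$ and an amenable tracial state $\tau$ on $\mathcal{U}$ such that $$\tau\circ\rho(e_a^x\otimes f_b^y)=p(a,b\mid x,y)\quad\text{for all } x\in X,\ y\in Y,\ a\in A,\ b\in B.$$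
   Context: A non-local game $\mathcal{G}=(X,Y,A,B,\lambda)$ consists of finite sets $X,Y$ (questions for Alice and Bob), finite sets $A,B$ (answers for Alice and Bob), and a scoring function $\lambda:X\times Y\times A\times B\to\{0,1\}$. The game is an imitation game if: (a) for any $x\in X$ and $a,a'\in A$ with $a\neq a'$, there exists $y\in Y$ such that $\sum_{b\in B}\lambda(x,y,a,b)\lambda(x,y,a',b)=0$; and (b) for any $y\in Y$ and $b,b'\in B$ with $b\neq b'$, there exists $x\in X$ such that $\sum_{a\in A}\lambda(x,y,a,b)\lambda(x,y,a,b')=0$. A non-signalling correlation is a function $p:X\times Y\times A\times B\to[0,1]$, written $p(a,b\mid x,y)$, such that $\sum_{b}p(a,b\mid x,y)=\sum_b p(a,b\mid x,y')$ for all $x\in X$, $y,y'\in Y$, $a\in A$; $\sum_a p(a,b\mid x,y)=\sum_a p(a,b\mid x',y)$ for all $x,x'\in X$, $y\in Y$, $b\in B$; and $\sum_{(a,b)\in A\times B}p(a,b\mid x,y)=1$ for all $x\in X$, $y\in Y$. The set of these is $\mathcal{C}_{ns}(X,Y,A,B)$. A correlation $p$ is perfect for $\mathcal{G}$ if $\lambda(x,y,a,b)=0$ implies $p(a,b\mid x,y)=0$; $\mathcal{C}_{ns}(\mathcal{G})$ is the set of perfect non-signalling correlations. $p\in\mathcal{C}_{ns}(X,Y,A,B)$ is a quantum correlation if there are finite-dimensional Hilbert spaces $\mathcal{H}_A,\mathcal{H}_B$, a unit vector $\psi\in\mathcal{H}_A\otimes\mathcal{H}_B$, and, for every $x\in X$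 and $y\in Y$, projection-valued measures $\{P_a^x:a\in A\}\subset\mathcal{B}(\mathcal{H}_A)$ and $\{Q_b^y:b\in B\}\subset\mathcal{B}(\mathcal{H}_B)$ (families of orthogonal projections summing to the identity) with $p(a,b\mid x,y)=\langle\psi|P_a^x\otimes Q_b^y|\psi\rangle$. The set of these is $\mathcal{C}_q(X,Y,A,B)$; its closure is $\mathcal{C}_{qa}(X,Y,A,B)$, and $\mathcal{C}_{qa}(\mathcal{G})=\mathcal{C}_{ns}(\mathcal{G})\cap\mathcal{C}_{qa}(X,Y,A,B)$. $\mathcal{A}(X,A)$ is the universal (unital) C$^*$-algebra generated by projections $e_a^x$ ($x\in X$, $a\in A$) satisfying $\sum_{a\in A}e_a^x=1$ for all $x\in X$; $\mathcal{A}(Y,B)$ is the universal C$^*$-algebra generated by projections $f_b^y$ ($y\in Y$, $b\in B$) satisfying $\sum_{b\in B}f_b^y=1$ for all $y\in Y$. $\otimes_{\min}$ is the minimal (spatial) C$^*$-tensor product. $\mathbb{C}\langle X,A\rangle\subset\mathcal{A}(X,A)$ is the $\mathbb{C}$-subalgebra generated by all the $e_a^x$ (it is a $*$-subalgebra), and $\mathbb{C}\langle Y,B\rangle\subset\mathcal{A}(Y,B)$ is the $\mathbb{C}$-subalgebra generated by all the $f_b^y$. $\otimes_{\mathrm{alg}}$ is the algebraic tensor product of $*$-algebras. A state is a positive linear functional with value $1$ at the unit; a state $\tau$ is tracial if $\tau(ab)=\tau(ba)$ for all $a,b$. A tracial state $\tau$ on a C$^*$-algebra $\mathcal{M}\subseteq\mathcal{B}(\mathcal{K})$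 is amenable if there is a state $\omega$ on $\mathcal{B}(\mathcal{K})$ with $\omega|_{\mathcal{M}}=\tau$ and $\omega(uTu^* )=\omega(T)$ for all $T\in\mathcal{B}(\mathcal{K})$ and all unitaries $u\in\mathcal{M}$. *)

theory Defs
  imports "HOL-Analysis.Analysis"
begin

section \<open>Complex Hilbert spaces\<close>

text \<open>The norm, the topology and completeness are those of the underlying real Hilbert space, whose
  inner product is the real part of the complex one.  The complex inner product is linear in its
  second argument.\<close>

class chilbert_space = real_inner + complete_space +
  fixes scaleC :: "complex \<Rightarrow> 'a \<Rightarrow> 'a" (infixr "*\<^sub>C" 75)
    and cinner :: "'a \<Rightarrow> 'a \<Rightarrow> complex"
  assumes scaleC_add_right: "c *\<^sub>C (x + y) = c *\<^sub>C x + c *\<^sub>C y"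
    and scaleC_add_left: "(c + d) *\<^sub>C x = c *\<^sub>C x + d *\<^sub>C x"
    and scaleC_scaleC: "c *\<^sub>C (d *\<^sub>C x) = (c * d) *\<^sub>C x"
    and scaleC_of_real: "complex_of_real r *\<^sub>C x = r *\<^sub>R x"
    and cinner_commute: "cinner x y = cnj (cinner y x)"
    and cinner_add_right: "cinner x (y + z) = cinner x y + cinner x z"
    and cinner_scaleC_right: "cinner x (c *\<^sub>C y) = c * cinner x y"
    and Re_cinner: "Re (cinner x y) = inner x y"

subclass (in chilbert_space) banach ..

section \<open>The Hilbert space \<open>\<ell>\<^sup>2(I)\<close>\<close>

typedef 'i ell2 = "{f :: 'i \<Rightarrow> complex. (\<lambda>i. (cmod (f i))\<^sup>2) summable_on UNIV}"
  morphisms coord Abs_ell2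
  by (rule exI[of _ "\<lambda>_. 0"]) simp

setup_lifting type_definition_ell2

lemma sq_summable_add:
  fixes f g :: "'i \<Rightarrow> complex"
  assumes "(\<lambda>i. (cmod (f i))\<^sup>2) summable_on UNIV" "(\<lambda>i. (cmod (g i))\<^sup>2) summable_on UNIV"
  shows "(\<lambda>i. (cmod (f i + g i))\<^sup>2) summable_on UNIV"
proof (rule summable_on_comparison_test)
  show "(\<lambda>i. 2 * (cmod (f i))\<^sup>2 + 2 * (cmod (g i))\<^sup>2) summable_on UNIV"
    by (intro summable_on_add summable_on_cmult_right assms)
  fix i
  have "(cmod (f i + g i))\<^sup>2 \<le> (cmod (f i) + cmod (g i))\<^sup>2"
    by (intro power_mono norm_triangle_ineq) auto
  also have "\<dots> \<le> 2 * (cmod (f i))\<^sup>2 + 2 * (cmod (g i))\<^sup>2"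
    using sum_squares_bound[of "cmod (f i)" "cmod (g i)"] by (simp add: power2_sum)
  finally show "(cmod (f i + g i))\<^sup>2 \<le> 2 * (cmod (f i))\<^sup>2 + 2 * (cmod (g i))\<^sup>2" .
qed auto

lemma sq_summable_scale:
  fixes f :: "'i \<Rightarrow> complex"
  assumes "(\<lambda>i. (cmod (f i))\<^sup>2) summable_on UNIV"
  shows "(\<lambda>i. (cmod (c * f i))\<^sup>2) summable_on UNIV"
  using summable_on_cmult_right[OF assms, of "(cmod c)\<^sup>2"] by (simp add: norm_mult power_mult_distrib)

lemma coord_sq_summable: "(\<lambda>i. (cmod (coord x i))\<^sup>2) summable_on UNIV"
  using coord[of x] by simp

lemma coord_mult_summable: "(\<lambda>i. cnj (coord x i) * coord y i) summable_on UNIV"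
proof -
  have "(\<lambda>i. norm (cnj (coord x i) * coord y i)) summable_on UNIV"
    by (rule Infinite_Sum.abs_summable_product)
      (use coord_sq_summable[of x] coord_sq_summable[of y] in \<open>simp_all add: norm_mult power2_eq_square\<close>)
  then show ?thesis by (rule Infinite_Sum.abs_summable_summable)
qed

instantiation ell2 :: (type) ab_group_add
begin

lift_definition zero_ell2 :: "'a ell2" is "\<lambda>_. 0" by simp
lift_definition plus_ell2 :: "'a ell2 \<Rightarrow> 'a ell2 \<Rightarrow> 'a ell2" is "\<lambda>f g i. f i + g i"
  by (rule sq_summable_add)
lift_definition uminus_ell2 :: "'a ell2 \<Rightarrow> 'a ell2" is "\<lambda>f i. - f i" by simp
lift_definition minus_ell2 :: "'a ell2 \<Rightarrow> 'a ell2 \<Rightarrow> 'a ell2" is "\<lambda>f g i. f i - g i"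
  subgoal for f g using sq_summable_add[of f "\<lambda>i. - g i"] by simp
  done

instance by standard (transfer; simp add: fun_eq_iff)+

end

lift_definition ell2_scaleC :: "complex \<Rightarrow> 'i ell2 \<Rightarrow> 'i ell2" is "\<lambda>c f i. c * f i"
  by (rule sq_summable_scale)

instantiation ell2 :: (type) real_vector
begin

definition scaleR_ell2 :: "real \<Rightarrow> 'a ell2 \<Rightarrow> 'a ell2" where
  "scaleR_ell2 r = ell2_scaleC (complex_of_real r)"

instance
  by standard (unfold scaleR_ell2_def; transfer; simp add: fun_eq_iff algebra_simps)+

end

lemma coord_simps [simp]:
  "coord 0 i = 0" "coord (x + y) i = coord x i + coord y i" "coord (- x) i = - coord x i"
  "coord (x - y) i = coord x i - coord y i" "coord (ell2_scaleC c x) i = c * coord x i"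
  by (simp_all add: zero_ell2.rep_eq plus_ell2.rep_eq uminus_ell2.rep_eq minus_ell2.rep_eq
      ell2_scaleC.rep_eq)

lemma ell2_eqI: "(\<And>i. coord x i = coord y i) \<Longrightarrow> x = y"
  by (simp add: coord_inject[symmetric] ext)

definition ell2_cinner :: "'i ell2 \<Rightarrow> 'i ell2 \<Rightarrow> complex" where
  "ell2_cinner x y = (\<Sum>\<^sub>\<infinity>i. cnj (coord x i) * coord y i)"

lemma ell2_cinner_add_right: "ell2_cinner x (y + z) = ell2_cinner x y + ell2_cinner x z"
  unfolding ell2_cinner_def
  by (simp add: distrib_left infsum_add coord_mult_summable)

lemma ell2_cinner_scaleC_right: "ell2_cinner x (ell2_scaleC c y) = c * ell2_cinner x y"
proof -
  have "cnj (coord x i) * coord (ell2_scaleC c y) i = c * (cnj (coord x i) * coord y i)" for i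
    by simp
  then show ?thesis
    by (simp only: ell2_cinner_def infsum_cmult_right[OF coord_mult_summable])
qed

lemma ell2_cinner_commute: "ell2_cinner x y = cnj (ell2_cinner y x)"
  unfolding ell2_cinner_def infsum_cnj[symmetric] by (simp add: mult.commute)

lemma Re_ell2_cinner_self: "Re (ell2_cinner x x) = (\<Sum>\<^sub>\<infinity>i. (cmod (coord x i))\<^sup>2)"
proof -
  have "Re (cnj z * z) = (cmod z)\<^sup>2" for z
    unfolding cmod_power2 by (simp add: power2_eq_square)
  then show ?thesis
    by (simp only: ell2_cinner_def infsum_Re[OF coord_mult_summable, symmetric])
qed

lemma ell2_sum_le:
  "finite F \<Longrightarrow> (\<Sum>i\<in>F. (cmod (coord x i))\<^sup>2) \<le> Re (ell2_cinner x x)"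
  unfolding Re_ell2_cinner_self by (rule finite_sum_le_infsum) (auto simp: coord_sq_summable)

instantiation ell2 :: (type) real_inner
begin

definition inner_ell2 :: "'a ell2 \<Rightarrow> 'a ell2 \<Rightarrow> real" where
  "inner_ell2 x y = Re (ell2_cinner x y)"
definition norm_ell2 :: "'a ell2 \<Rightarrow> real" where
  "norm_ell2 x = sqrt (inner x x)"
definition dist_ell2 :: "'a ell2 \<Rightarrow> 'a ell2 \<Rightarrow> real" where
  "dist_ell2 x y = norm (x - y)"
definition sgn_ell2 :: "'a ell2 \<Rightarrow> 'a ell2" where
  "sgn_ell2 x = x /\<^sub>R norm x"
definition uniformity_ell2 :: "('a ell2 \<times> 'a ell2) filter" where
  "uniformity_ell2 = (INF e\<in>{0<..}. principal {(x, y). dist x y < e})"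
definition open_ell2 :: "'a ell2 set \<Rightarrow> bool" where
  "open_ell2 U = (\<forall>x\<in>U. eventually (\<lambda>(x', y). x' = x \<longrightarrow> y \<in> U) uniformity)"

instance
proof
  fix x y z :: "'a ell2" and r :: real
  show comm: "inner x y = inner y x" for x y :: "'a ell2"
    unfolding inner_ell2_def using ell2_cinner_commute[of x y] by simp
  have "inner z (x + y) = inner z x + inner z y"
    by (simp add: inner_ell2_def ell2_cinner_add_right)
  then show "inner (x + y) z = inner x z + inner y z"
    by (simp only: comm[of _ z])
  have "inner y (r *\<^sub>R x) = r * inner y x"
    by (simp add: inner_ell2_def scaleR_ell2_def ell2_cinner_scaleC_right)
  then show "inner (r *\<^sub>R x) y = r * inner x y"
    by (simp only: comm[of _ y])
  show "0 \<le> inner x x"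
    by (simp add: inner_ell2_def Re_ell2_cinner_self infsum_nonneg)
  show "inner x x = 0 \<longleftrightarrow> x = 0"
  proof
    assume "inner x x = 0"
    then have "(cmod (coord x i))\<^sup>2 \<le> 0" for i
      using ell2_sum_le[of "{i}" x] by (simp add: inner_ell2_def)
    then show "x = 0" by (intro ell2_eqI) simp
  qed (simp add: inner_ell2_def Re_ell2_cinner_self)
qed (rule norm_ell2_def dist_ell2_def sgn_ell2_def uniformity_ell2_def open_ell2_def)+

end

lemma ell2_sq_norm: "(norm (x::'i ell2))\<^sup>2 = (\<Sum>\<^sub>\<infinity>i. (cmod (coord x i))\<^sup>2)"
  unfolding power2_norm_eq_inner[of x] inner_ell2_def by (rule Re_ell2_cinner_self)

lemma ell2_sum_le_norm: "finite F \<Longrightarrow> (\<Sum>i\<in>F. (cmod (coord x i))\<^sup>2) \<le> (norm (x::'i ell2))\<^sup>2"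
  unfolding power2_norm_eq_inner[of x] inner_ell2_def by (rule ell2_sum_le)

lemma ell2_coord_le: "cmod (coord x i) \<le> norm (x::'i ell2)"
  by (rule power2_le_imp_le) (use ell2_sum_le_norm[of "{i}" x] in auto)

instance ell2 :: (type) complete_space
proof
  fix X :: "nat \<Rightarrow> 'a ell2"
  assume "Cauchy X"
  define f where "f i = lim (\<lambda>n. coord (X n) i)" for i
  have "Cauchy (\<lambda>n. coord (X n) i)" for i
  proof (rule metric_CauchyI)
    fix e :: real assume "0 < e"
    then obtain M where "\<forall>m\<ge>M. \<forall>n\<ge>M. dist (X m) (X n) < e"
      using metric_CauchyD[OF \<open>Cauchy X\<close>] by blast
    moreover have "dist (coord (X m) i) (coord (X n) i) \<le> dist (X m) (X n)" for m n
      using ell2_coord_le[of "X m - X n" i] by (simp add: dist_norm)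
    ultimately have "\<forall>m\<ge>M. \<forall>n\<ge>M. dist (coord (X m) i) (coord (X n) i) < e"
      using order.strict_trans1 by blast
    then show "\<exists>M. \<forall>m\<ge>M. \<forall>n\<ge>M. dist (coord (X m) i) (coord (X n) i) < e" ..
  qed
  then have f: "(\<lambda>n. coord (X n) i) \<longlonglongrightarrow> f i" for i
    by (simp add: f_def Cauchy_convergent convergent_LIMSEQ_iff[symmetric])
  have bound: "(\<Sum>i\<in>F. (cmod (f i - coord (X m) i))\<^sup>2) \<le> e\<^sup>2"
    if "\<forall>n\<ge>M. dist (X n) (X m) < e" "finite F" for M m e F
  proof (rule Lim_bounded)
    show "(\<lambda>n. \<Sum>i\<in>F. (cmod (coord (X n) i - coord (X m) i))\<^sup>2)
        \<longlonglongrightarrow> (\<Sum>i\<in>F. (cmod (f i - coord (X m) i))\<^sup>2)"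
      by (intro tendsto_intros f)
    show "\<forall>n\<ge>M. (\<Sum>i\<in>F. (cmod (coord (X n) i - coord (X m) i))\<^sup>2) \<le> e\<^sup>2"
    proof (intro allI impI)
      fix n assume "M \<le> n"
      then have "norm (X n - X m) < e" using that(1) by (simp add: dist_norm)
      then have "(norm (X n - X m))\<^sup>2 \<le> e\<^sup>2"
        by (intro power_mono norm_ge_zero) simp
      then show "(\<Sum>i\<in>F. (cmod (coord (X n) i - coord (X m) i))\<^sup>2) \<le> e\<^sup>2"
        using ell2_sum_le_norm[OF \<open>finite F\<close>, of "X n - X m"] by simp
    qed
  qed
  obtain M1 where M1: "\<forall>m\<ge>M1. \<forall>n\<ge>M1. dist (X m) (X n) < 1"
    using metric_CauchyD[OF \<open>Cauchy X\<close>, of 1] by auto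
  have "(\<lambda>i. (cmod (f i - coord (X M1) i))\<^sup>2) summable_on UNIV"
    using bound[of M1 M1 1] M1 by (intro nonneg_bdd_above_summable_on bdd_aboveI2[of _ _ "1\<^sup>2"]) auto
  from sq_summable_add[OF this coord_sq_summable[of "X M1"]]
  have "f \<in> {f. (\<lambda>i. (cmod (f i))\<^sup>2) summable_on UNIV}" by simp
  then have cL: "coord (Abs_ell2 f) = f" by (rule Abs_ell2_inverse)
  have "X \<longlonglongrightarrow> Abs_ell2 f"
  proof (rule metric_LIMSEQ_I)
    fix r :: real assume "0 < r"
    then obtain M where M: "\<forall>m\<ge>M. \<forall>n\<ge>M. dist (X m) (X n) < r / 2"
      using metric_CauchyD[OF \<open>Cauchy X\<close>, of "r / 2"] by auto
    have "dist (X n) (Abs_ell2 f) < r" if "n \<ge> M" for n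
    proof -
      have "(norm (Abs_ell2 f - X n))\<^sup>2 \<le> (r / 2)\<^sup>2"
        unfolding ell2_sq_norm using bound[of M n "r / 2"] M that
        by (intro infsum_le_finite_sums coord_sq_summable) (simp add: cL)
      then have "norm (Abs_ell2 f - X n) \<le> r / 2"
        by (rule power2_le_imp_le) (use \<open>0 < r\<close> in simp)
      then have "dist (Abs_ell2 f) (X n) < r" using \<open>0 < r\<close> by (simp add: dist_norm)
      then show ?thesis by (simp only: dist_commute)
    qed
    then show "\<exists>M. \<forall>n\<ge>M. dist (X n) (Abs_ell2 f) < r" by blast
  qed
  then show "convergent X" by (rule convergentI)
qed

instantiation ell2 :: (type) chilbert_space
begin

definition "scaleC_ell2 = ell2_scaleC"
definition "cinner_ell2 = ell2_cinner"

instance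
proof
  fix x y z :: "'a ell2" and a :: real and c d :: complex
  show "c *\<^sub>C (x + y) = c *\<^sub>C x + c *\<^sub>C y" "(c + d) *\<^sub>C x = c *\<^sub>C x + d *\<^sub>C x"
    "c *\<^sub>C (d *\<^sub>C x) = (c * d) *\<^sub>C x" "complex_of_real a *\<^sub>C x = a *\<^sub>R x"
    unfolding scaleC_ell2_def by (rule ell2_eqI, simp add: algebra_simps scaleR_ell2_def)+
  show "cinner x y = cnj (cinner y x)"
    unfolding cinner_ell2_def by (rule ell2_cinner_commute)
  show "cinner x (y + z) = cinner x y + cinner x z"
    unfolding cinner_ell2_def by (rule ell2_cinner_add_right)
  show "cinner x (c *\<^sub>C y) = c * cinner x y"
    unfolding cinner_ell2_def scaleC_ell2_def by (rule ell2_cinner_scaleC_right)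
  show "Re (cinner x y) = inner x y" by (simp add: inner_ell2_def cinner_ell2_def)
qed

end

section \<open>Bounded operators\<close>

type_synonym 'h operator = "'h \<Rightarrow>\<^sub>L 'h"

text \<open>Elements of \<^typ>\<open>'h operator\<close> are only real linear; \<open>B(H)\<close> is the set \<open>bop\<close>.\<close>

definition bop :: "'h::chilbert_space operator set" where
  "bop = {T. \<forall>c x. blinfun_apply T (c *\<^sub>C x) = c *\<^sub>C blinfun_apply T x}"

definition op_scale :: "complex \<Rightarrow> 'h::chilbert_space operator \<Rightarrow> 'h operator" where
  "op_scale c T = Blinfun (\<lambda>x. c *\<^sub>C blinfun_apply T x)"

definition adj :: "'h::chilbert_space operator \<Rightarrow> 'h operator" where
  "adj T = (THE S. \<forall>x y. cinner (blinfun_apply S x) y = cinner x (blinfun_apply T y))"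

definition projection :: "'h::chilbert_space operator \<Rightarrow> bool" where
  "projection P \<longleftrightarrow> P \<in> bop \<and> adj P = P \<and> P o\<^sub>L P = P"

text \<open>\<open>E\<close> is the identity of the Hilbert space on which the measure lives: \<open>id_blinfun\<close> for the
  whole space, or the projection onto a closed subspace \<open>L\<close>.  In the latter case \<open>\<Sum>\<^sub>a P a = E\<close>
  forces every \<open>P a\<close> to vanish on the complement of \<open>L\<close> and to map \<open>L\<close> into itself.\<close>

definition pvm :: "'a set \<Rightarrow> 'h::chilbert_space operator \<Rightarrow> ('a \<Rightarrow> 'h operator) \<Rightarrow> bool" where
  "pvm A E P \<longleftrightarrow> (\<forall>a\<in>A. projection (P a)) \<and> (\<Sum>a\<in>A. P a) = E"

section \<open>Operator algebras\<close>

definition subalgebra :: "'h::chilbert_space operator set \<Rightarrow> bool" where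
  "subalgebra M \<longleftrightarrow> M \<subseteq> bop \<and> 0 \<in> M \<and>
     (\<forall>S\<in>M. \<forall>T\<in>M. S + T \<in> M \<and> S o\<^sub>L T \<in> M) \<and> (\<forall>c. \<forall>T\<in>M. op_scale c T \<in> M)"

definition cstar_algebra :: "'h::chilbert_space operator set \<Rightarrow> bool" where
  "cstar_algebra M \<longleftrightarrow>
     subalgebra M \<and> (\<forall>T\<in>M. adj T \<in> M) \<and> id_blinfun \<in> M \<and> closed M"

definition commutant :: "'h::chilbert_space operator set \<Rightarrow> 'h operator set" where
  "commutant M = {T \<in> bop. \<forall>S\<in>M. S o\<^sub>L T = T o\<^sub>L S}"

definition von_neumann_algebra :: "'h::chilbert_space operator set \<Rightarrow> bool" where
  "von_neumann_algebra U \<longleftrightarrow>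
     subalgebra U \<and> (\<forall>T\<in>U. adj T \<in> U) \<and> commutant (commutant U) = U"

definition generated_algebra :: "'h::chilbert_space operator set \<Rightarrow> 'h operator set" where
  "generated_algebra G = \<Inter>{M. subalgebra M \<and> G \<subseteq> M}"

definition generated_cstar_algebra :: "'h::chilbert_space operator set \<Rightarrow> 'h operator set" where
  "generated_cstar_algebra G = \<Inter>{M. cstar_algebra M \<and> G \<subseteq> M}"

text \<open>Homomorphisms are unital.\<close>

definition star_hom ::
  "'h::chilbert_space operator set \<Rightarrow> 'k::chilbert_space operator set \<Rightarrow>
    ('h operator \<Rightarrow> 'k operator) \<Rightarrow> bool" where
  "star_hom M N \<theta> \<longleftrightarrow> \<theta> ` M \<subseteq> N \<and> \<theta> id_blinfun = id_blinfun \<and>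
     (\<forall>S\<in>M. \<forall>T\<in>M. \<theta> (S + T) = \<theta> S + \<theta> T \<and> \<theta> (S o\<^sub>L T) = \<theta> S o\<^sub>L \<theta> T) \<and>
     (\<forall>c. \<forall>T\<in>M. \<theta> (op_scale c T) = op_scale c (\<theta> T)) \<and>
     (\<forall>T\<in>M. \<theta> (adj T) = adj (\<theta> T))"

definition state :: "'h::chilbert_space operator set \<Rightarrow> ('h operator \<Rightarrow> complex) \<Rightarrow> bool" where
  "state M \<phi> \<longleftrightarrow>
     (\<forall>S\<in>M. \<forall>T\<in>M. \<phi> (S + T) = \<phi> S + \<phi> T) \<and> (\<forall>c. \<forall>T\<in>M. \<phi> (op_scale c T) = c * \<phi> T) \<and>
     (\<forall>T\<in>M. \<phi> (adj T o\<^sub>L T) \<in> \<real>\<^sub>\<ge>\<^sub>0) \<and> \<phi> id_blinfun = 1"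

definition tracial_state :: "'h::chilbert_space operator set \<Rightarrow> ('h operator \<Rightarrow> complex) \<Rightarrow> bool" where
  "tracial_state M \<tau> \<longleftrightarrow> state M \<tau> \<and> (\<forall>S\<in>M. \<forall>T\<in>M. \<tau> (S o\<^sub>L T) = \<tau> (T o\<^sub>L S))"

definition unitary :: "'h::chilbert_space operator \<Rightarrow> bool" where
  "unitary u \<longleftrightarrow> u \<in> bop \<and> adj u o\<^sub>L u = id_blinfun \<and> u o\<^sub>L adj u = id_blinfun"

definition amenable_tracial_state ::
  "'h::chilbert_space operator set \<Rightarrow> ('h operator \<Rightarrow> complex) \<Rightarrow> bool" where
  "amenable_tracial_state M \<tau> \<longleftrightarrow> tracial_state M \<tau> \<and>
     (\<exists>\<omega>. state bop \<omega> \<and> (\<forall>T\<in>M. \<omega> T = \<tau> T) \<and>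
       (\<forall>T\<in>bop. \<forall>u\<in>M. unitary u \<longrightarrow> \<omega> (u o\<^sub>L T o\<^sub>L adj u) = \<omega> T))"

section \<open>Tensor products\<close>

lemma sq_summable_times:
  fixes v :: "'i \<Rightarrow> complex" and w :: "'j \<Rightarrow> complex"
  assumes v: "(\<lambda>i. (cmod (v i))\<^sup>2) summable_on UNIV" and w: "(\<lambda>j. (cmod (w j))\<^sup>2) summable_on UNIV"
  shows "(\<lambda>k. (cmod (case k of (i, j) \<Rightarrow> v i * w j))\<^sup>2) summable_on UNIV"
proof -
  let ?c = "\<Sum>\<^sub>\<infinity>j. (cmod (w j))\<^sup>2"
  have "(\<lambda>k. (cmod (case k of (i, j) \<Rightarrow> v i * w j))\<^sup>2) summable_on (UNIV \<times> UNIV)"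
  proof (rule summable_on_SigmaI)
    show "((\<lambda>j. (cmod (case (i, j) of (i, j) \<Rightarrow> v i * w j))\<^sup>2) has_sum ((cmod (v i))\<^sup>2 * ?c)) UNIV" for i
      using has_sum_cmult_right[OF has_sum_infsum[OF w]]
      by (simp add: norm_mult power_mult_distrib)
    show "(\<lambda>i. (cmod (v i))\<^sup>2 * ?c) summable_on UNIV"
      by (rule summable_on_cmult_left[OF v])
  qed simp
  then show ?thesis by simp
qed

lift_definition tensor_vec :: "'i ell2 \<Rightarrow> 'j ell2 \<Rightarrow> ('i \<times> 'j) ell2" (infixr "\<otimes>\<^sub>v" 70)
  is "\<lambda>v w (i, j). v i * w j"
  by (rule sq_summable_times)

definition tensor_op ::
  "'i ell2 operator \<Rightarrow> 'j ell2 operator \<Rightarrow> ('i \<times> 'j) ell2 operator" (infixr "\<otimes>\<^sub>o" 70) where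
  "S \<otimes>\<^sub>o T = (THE R. R \<in> bop \<and>
     (\<forall>v w. blinfun_apply R (v \<otimes>\<^sub>v w) = blinfun_apply S v \<otimes>\<^sub>v blinfun_apply T w))"

text \<open>For \<open>M \<subseteq> B(\<ell>\<^sup>2(I))\<close> and \<open>N \<subseteq> B(\<ell>\<^sup>2(J))\<close> the canonical map from the algebraic tensor product
  of \<open>M\<close> and \<open>N\<close> to \<open>B(\<ell>\<^sup>2(I \<times> J))\<close> is injective, so the algebraic tensor product is taken to be the
  span of the elementary tensors there.  Scalars are absorbed in the first factor.\<close>

definition alg_tensor ::
  "'i ell2 operator set \<Rightarrow> 'j ell2 operator set \<Rightarrow> ('i \<times> 'j) ell2 operator set" where
  "alg_tensor M N = {R. \<exists>(n::nat) S T. (\<forall>k<n. S k \<in> M \<and> T k \<in> N) \<and> R = (\<Sum>k<n. S k \<otimes>\<^sub>o T k)}"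

definition min_tensor ::
  "'i ell2 operator set \<Rightarrow> 'j ell2 operator set \<Rightarrow> ('i \<times> 'j) ell2 operator set" where
  "min_tensor M N = closure (alg_tensor M N)"

section \<open>The universal C*-algebra of a family of projection-valued measures\<close>

definition generators ::
  "'x set \<Rightarrow> 'a set \<Rightarrow> ('x \<Rightarrow> 'a \<Rightarrow> 'h operator) \<Rightarrow> 'h::chilbert_space operator set"
  where "generators X A e = {e x a | x a. x \<in> X \<and> a \<in> A}"

text \<open>\<open>\<A>\<close>, acting faithfully on \<open>H\<close>, is the universal unital C*-algebra generated by the projections
  \<open>e x a\<close>.  It is enough to test the universal property on \<open>\<ell>\<^sup>2(\<nat>)\<close>: for finite \<open>X\<close> and \<open>A\<close>, a
  C*-algebra generated by projections indexed by \<open>X \<times> A\<close> is separable, hence acts faithfully and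
  unitally on \<open>\<ell>\<^sup>2(\<nat>)\<close> unless it is zero.  Homomorphisms out of \<open>\<A>\<close> are determined by their values on
  the generators, so uniqueness needs no mention.\<close>

definition universal_pvm_algebra ::
  "'x set \<Rightarrow> 'a set \<Rightarrow> 'h::chilbert_space operator set \<Rightarrow> ('x \<Rightarrow> 'a \<Rightarrow> 'h operator) \<Rightarrow> bool" where
  "universal_pvm_algebra X A \<A> e \<longleftrightarrow>
     (\<forall>x\<in>X. pvm A id_blinfun (e x)) \<and>
     \<A> = generated_cstar_algebra (generators X A e) \<and>
     (\<forall>P :: 'x \<Rightarrow> 'a \<Rightarrow> nat ell2 operator. (\<forall>x\<in>X. pvm A id_blinfun (P x)) \<longrightarrow>
       (\<exists>\<theta>. star_hom \<A> bop \<theta> \<and> (\<forall>x\<in>X. \<forall>a\<in>A. \<theta> (e x a) = P x a)))"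

section \<open>Representations\<close>

definition gns_triple ::
  "'k::chilbert_space operator set \<Rightarrow> ('k operator \<Rightarrow> complex) \<Rightarrow>
    ('k operator \<Rightarrow> 'h::chilbert_space operator) \<Rightarrow> 'h \<Rightarrow> bool" where
  "gns_triple M \<phi> \<pi> \<psi> \<longleftrightarrow>
     star_hom M bop \<pi> \<and> norm \<psi> = 1 \<and> closure {blinfun_apply (\<pi> c) \<psi> | c. c \<in> M} = UNIV \<and>
     (\<forall>c\<in>M. \<phi> c = cinner \<psi> (blinfun_apply (\<pi> c) \<psi>))"

section \<open>Games and correlations\<close>

definition nonlocal_game ::
  "'x set \<Rightarrow> 'y set \<Rightarrow> 'a set \<Rightarrow> 'b set \<Rightarrow> ('x \<Rightarrow> 'y \<Rightarrow> 'a \<Rightarrow> 'b \<Rightarrow> nat) \<Rightarrow> bool" where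
  "nonlocal_game X Y A B \<Lambda> \<longleftrightarrow> finite X \<and> finite Y \<and> finite A \<and> finite B \<and>
     (\<forall>x\<in>X. \<forall>y\<in>Y. \<forall>a\<in>A. \<forall>b\<in>B. \<Lambda> x y a b \<in> {0, 1})"

definition imitation_game ::
  "'x set \<Rightarrow> 'y set \<Rightarrow> 'a set \<Rightarrow> 'b set \<Rightarrow> ('x \<Rightarrow> 'y \<Rightarrow> 'a \<Rightarrow> 'b \<Rightarrow> nat) \<Rightarrow> bool" where
  "imitation_game X Y A B \<Lambda> \<longleftrightarrow> nonlocal_game X Y A B \<Lambda> \<and>
     (\<forall>x\<in>X. \<forall>a\<in>A. \<forall>a'\<in>A. a \<noteq> a' \<longrightarrow> (\<exists>y\<in>Y. (\<Sum>b\<in>B. \<Lambda> x y a b * \<Lambda> x y a' b) = 0)) \<and>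
     (\<forall>y\<in>Y. \<forall>b\<in>B. \<forall>b'\<in>B. b \<noteq> b' \<longrightarrow> (\<exists>x\<in>X. (\<Sum>a\<in>A. \<Lambda> x y a b * \<Lambda> x y a b') = 0))"

text \<open>\<open>p x y a b\<close> stands for \<open>p(a,b | x,y)\<close>.  Only the values on \<open>X \<times> Y \<times> A \<times> B\<close> matter; all the sets
  of correlations below are cylinders over this finite product, so that closures in the product
  topology are closures with respect to these finitely many values.\<close>

type_synonym ('x, 'y, 'a, 'b) correlation = "'x \<Rightarrow> 'y \<Rightarrow> 'a \<Rightarrow> 'b \<Rightarrow> real"

definition C_ns :: "'x set \<Rightarrow> 'y set \<Rightarrow> 'a set \<Rightarrow> 'b set \<Rightarrow> ('x, 'y, 'a, 'b) correlation set" where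
  "C_ns X Y A B = {p.
     (\<forall>x\<in>X. \<forall>y\<in>Y. \<forall>a\<in>A. \<forall>b\<in>B. 0 \<le> p x y a b \<and> p x y a b \<le> 1) \<and>
     (\<forall>x\<in>X. \<forall>y\<in>Y. \<forall>y'\<in>Y. \<forall>a\<in>A. (\<Sum>b\<in>B. p x y a b) = (\<Sum>b\<in>B. p x y' a b)) \<and>
     (\<forall>x\<in>X. \<forall>x'\<in>X. \<forall>y\<in>Y. \<forall>b\<in>B. (\<Sum>a\<in>A. p x y a b) = (\<Sum>a\<in>A. p x' y a b)) \<and>
     (\<forall>x\<in>X. \<forall>y\<in>Y. (\<Sum>(a, b)\<in>A \<times> B. p x y a b) = 1)}"

text \<open>A finite-dimensional Hilbert space is, up to isomorphism, the range of a finite-rank projection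
  on \<open>\<ell>\<^sup>2(\<nat>)\<close>; \<open>E\<close> and \<open>F\<close> are the projections onto the Hilbert spaces of Alice and Bob, and
  \<open>(E \<otimes> F) \<psi> = \<psi>\<close> says that \<open>\<psi>\<close> lies in the tensor product of their ranges.\<close>

definition finite_rank :: "'h::chilbert_space operator \<Rightarrow> bool" where
  "finite_rank T \<longleftrightarrow> (\<exists>S. finite S \<and> range (blinfun_apply T) \<subseteq> span S)"

definition C_q :: "'x set \<Rightarrow> 'y set \<Rightarrow> 'a set \<Rightarrow> 'b set \<Rightarrow> ('x, 'y, 'a, 'b) correlation set" where
  "C_q X Y A B = {p \<in> C_ns X Y A B.
     \<exists>(E :: nat ell2 operator) (F :: nat ell2 operator) \<psi> P Q.
       projection E \<and> finite_rank E \<and> projection F \<and> finite_rank F \<and>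
       norm \<psi> = 1 \<and> blinfun_apply (E \<otimes>\<^sub>o F) \<psi> = \<psi> \<and>
       (\<forall>x\<in>X. pvm A E (P x)) \<and> (\<forall>y\<in>Y. pvm B F (Q y)) \<and>
       (\<forall>x\<in>X. \<forall>y\<in>Y. \<forall>a\<in>A. \<forall>b\<in>B.
          complex_of_real (p x y a b) = cinner \<psi> (blinfun_apply (P x a \<otimes>\<^sub>o Q y b) \<psi>))}"

definition C_qa :: "'x set \<Rightarrow> 'y set \<Rightarrow> 'a set \<Rightarrow> 'b set \<Rightarrow> ('x, 'y, 'a, 'b) correlation set" where
  "C_qa X Y A B = closure (C_q X Y A B)"

definition perfect ::
  "'x set \<Rightarrow> 'y set \<Rightarrow> 'a set \<Rightarrow> 'b set \<Rightarrow> ('x \<Rightarrow> 'y \<Rightarrow> 'a \<Rightarrow> 'b \<Rightarrow> nat) \<Rightarrow>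
    ('x, 'y, 'a, 'b) correlation \<Rightarrow> bool" where
  "perfect X Y A B \<Lambda> p \<longleftrightarrow>
     (\<forall>x\<in>X. \<forall>y\<in>Y. \<forall>a\<in>A. \<forall>b\<in>B. \<Lambda> x y a b = 0 \<longrightarrow> p x y a b = 0)"

definition C_ns_game ::
  "'x set \<Rightarrow> 'y set \<Rightarrow> 'a set \<Rightarrow> 'b set \<Rightarrow> ('x \<Rightarrow> 'y \<Rightarrow> 'a \<Rightarrow> 'b \<Rightarrow> nat) \<Rightarrow>
    ('x, 'y, 'a, 'b) correlation set" where
  "C_ns_game X Y A B \<Lambda> = {p \<in> C_ns X Y A B. perfect X Y A B \<Lambda> p}"

definition C_qa_game ::
  "'x set \<Rightarrow> 'y set \<Rightarrow> 'a set \<Rightarrow> 'b set \<Rightarrow> ('x \<Rightarrow> 'y \<Rightarrow> 'a \<Rightarrow> 'b \<Rightarrow> nat) \<Rightarrow>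
    ('x, 'y, 'a, 'b) correlation set" where
  "C_qa_game X Y A B \<Lambda> = C_ns_game X Y A B \<Lambda> \<inter> C_qa X Y A B"

end

theory Submission
  imports Defs
begin

text \<open>
  A perfect correlation of an imitation game in which Alice has two questions and two answers is
  classical if it comes from a state on the tensor product: it is a convex combination of
  deterministic strategies.  Once this is known, \<open>U\<close> can be taken to be the algebra of diagonal operators on
  \<open>\<ell>\<^sup>2(\<nat>)\<close>.  The deterministic strategies give characters of the two universal algebras, a
  pair of characters gives one diagonal entry of \<open>\<rho>\<close>, and \<open>\<tau>\<close> weights the entries.  The same
  weighted sum of diagonal entries is a state on all bounded operators; it is invariant under diagonal
  unitaries because the phases cancel.

  Why the correlation is classical: write \<open>P x a\<close> and \<open>Q y b\<close> for the images of the generators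
  under the GNS representation, and let \<open>x\<close>, \<open>x'\<close> be Alice's questions.  Her two answers to a
  question are separated by some question of Bob's, so on the cyclic vector \<open>\<psi>\<close> each \<open>P x a\<close>
  agrees with an operator \<open>F\<close> of Bob's.  Since \<open>F\<close> commutes with Alice's projections, the
  state is tracial enough to give
  \<open>(norm (P x a (P x' d \<psi>)))\<^sup>2 = inner (P x a \<psi>) (P x' d \<psi>) = (norm (P x' d (P x a \<psi>)))\<^sup>2\<close>
  (\<open>norm_P_P\<close>).  So \<open>q a d = inner (P x a \<psi>) (P x' d \<psi>)\<close> is a probability distribution on
  pairs of answers, and it serves as the hidden variable.

  It remains to let Bob answer each \<open>y\<close> as a function of the pair.  Two answers \<open>b\<close>, \<open>b'\<close> are
  separated by \<open>x\<close> or by \<open>x'\<close>.  If Alice's answer to one of her questions determines \<open>b\<close>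
  with certainty, Bob computes \<open>b\<close> from that component.  Otherwise the pairs that can win together
  with the various \<open>b\<close> are disjoint rectangles in a two by two square which do not split it along
  a single line; such a configuration contains a single point, and this forces Alice's projections
  to commute on \<open>\<psi>\<close> (\<open>commute_if_undetermined\<close>).  Then \<open>q\<close> is the distribution of a joint
  measurement, and Bob answers by the rectangle that contains the pair.

  The preparation supplies adjoints (by the Riesz representation theorem), tensor products of bounded
  operators, and the extension of a pair of homomorphisms with diagonal values to the algebraic tensor
  product (\<open>product_hom_exists\<close>).
\<close>


section \<open>Complex inner products and adjoints\<close>

lemma cinner_add_left: "cinner (x + y) z = cinner x z + cinner y (z::'h::chilbert_space)"
  by (metis cinner_commute cinner_add_right complex_cnj_add)

lemma cinner_scaleC_left: "cinner (c *\<^sub>C x) z = cnj c * cinner x (z::'h::chilbert_space)"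
  by (metis cinner_commute cinner_scaleC_right complex_cnj_mult)

lemma cinner_scaleR_right: "cinner x (r *\<^sub>R y) = complex_of_real r * cinner x (y::'h::chilbert_space)"
  by (metis cinner_scaleC_right scaleC_of_real)

lemma cinner_minus_right: "cinner x (- y) = - cinner x (y::'h::chilbert_space)"
  using cinner_scaleR_right[of x "-1" y] by simp

lemma cinner_diff_right: "cinner x (y - z) = cinner x y - cinner x (z::'h::chilbert_space)"
  using cinner_add_right[of x y "- z"] by (simp add: cinner_minus_right)

lemma cinner_zero_right [simp]: "cinner x (0::'h::chilbert_space) = 0"
  using cinner_scaleR_right[of x 0 0] by simp

lemma cinner_zero_left [simp]: "cinner (0::'h::chilbert_space) x = 0"
  by (metis cinner_commute cinner_zero_right complex_cnj_zero)

lemma cinner_sum_right: "cinner x (\<Sum>i\<in>I. f i) = (\<Sum>i\<in>I. cinner x (f i :: 'h::chilbert_space))"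
  by (induction I rule: infinite_finite_induct) (simp_all add: cinner_add_right)

lemma cinner_self: "cinner x x = complex_of_real ((norm (x::'h::chilbert_space))\<^sup>2)"
proof -
  have "Im (cinner x x) = 0"
    using arg_cong[OF cinner_commute[of x x], of Im] by simp
  then show ?thesis
    by (simp add: complex_eq_iff Re_cinner power2_norm_eq_inner)
qed

lemma cinner_ext:
  assumes "\<And>z. cinner z x = cinner z (y::'h::chilbert_space)"
  shows "x = y"
proof -
  have "cinner (x - y) (x - y) = 0"
    using assms by (simp add: cinner_diff_right)
  then show ?thesis by (simp add: cinner_self)
qed

lemma Im_cinner: "Im (cinner x y) = inner x ((- \<i>) *\<^sub>C (y::'h::chilbert_space))"
  by (simp add: Re_cinner[symmetric] cinner_scaleC_right)

lemma norm_scaleC: "norm (c *\<^sub>C x) = cmod c * norm (x::'h::chilbert_space)"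
proof -
  have "complex_of_real ((norm (c *\<^sub>C x))\<^sup>2) = c * cnj c * complex_of_real ((norm x)\<^sup>2)"
    unfolding cinner_self[symmetric] by (simp add: cinner_scaleC_right cinner_scaleC_left)
  also have "\<dots> = complex_of_real ((cmod c * norm x)\<^sup>2)"
    by (simp add: power_mult_distrib complex_norm_square[symmetric] flip: of_real_power)
  finally show ?thesis
    using of_real_eq_iff power2_eq_iff_nonneg by (metis mult_nonneg_nonneg norm_ge_zero)
qed

lemma scaleC_zero_right [simp]: "c *\<^sub>C (0::'h::chilbert_space) = 0"
  using norm_scaleC[of c 0] by simp

text \<open>The minimum of \<open>\<lambda>x. (norm x)\<^sup>2 / 2 - F x\<close> represents \<open>F\<close>: by the parallelogram law every
  minimising sequence is Cauchy, and stationarity at the limit in every direction is the claim.\<close>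

lemma riesz_representation:
  fixes F :: "'h::{real_inner, complete_space} \<Rightarrow> real"
  assumes F: "bounded_linear F"
  obtains z where "\<And>x. F x = inner z x"
proof -
  interpret F: bounded_linear F by (rule F)
  define J where "J x = (norm x)\<^sup>2 / 2 - F x" for x
  obtain K where K: "\<And>x. norm (F x) \<le> norm x * K" using F.bounded by blast
  have lower: "- K\<^sup>2 / 2 \<le> J x" for x
  proof -
    have "0 \<le> (norm x - K)\<^sup>2" by simp
    then show ?thesis using K[of x] by (simp add: J_def power2_diff)
  qed
  define m where "m = Inf (range J)"
  have bdd: "bdd_below (range J)" using lower by (auto intro!: bdd_belowI)
  have m_le: "m \<le> J x" for x unfolding m_def by (rule cINF_lower[OF bdd]) simp
  have "\<exists>x. J x < m + inverse (Suc n)" for n :: nat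
    using cInf_lessD[of "range J" "m + inverse (Suc n)"] by (auto simp: m_def)
  then obtain X where X: "\<And>n. J (X n) < m + inverse (Suc n)" by metis
  have par: "(norm (x - y))\<^sup>2 / 4 = J x + J y - 2 * J ((1/2) *\<^sub>R (x + y))" for x y
    by (simp add: J_def F.scaleR F.add power2_norm_eq_inner inner_add_left inner_add_right
        inner_diff_left inner_diff_right inner_commute field_simps)
  have quarter: "a \<le> 4 * (u + v)" if "a / 4 = b + c - 2 * d" "m \<le> d" "b < m + u" "c < m + v"
    for a b c d u v :: real
    using that by argo
  have close: "(norm (X i - X j))\<^sup>2 \<le> 4 * (inverse (Suc i) + inverse (Suc j))" for i j
    by (rule quarter[OF par m_le X X])
  have "Cauchy X"
  proof (rule metric_CauchyI)
    fix r :: real assume r: "0 < r"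
    then obtain N where N: "inverse (Suc N) < r\<^sup>2 / 8"
      using reals_Archimedean[of "r\<^sup>2 / 8"] by auto
    have "dist (X i) (X j) < r" if "N \<le> i" "N \<le> j" for i j
    proof -
      have "inverse (Suc i) \<le> inverse (real (Suc N))" "inverse (Suc j) \<le> inverse (real (Suc N))"
        using that by (auto intro!: le_imp_inverse_le)
      then have "(norm (X i - X j))\<^sup>2 < r\<^sup>2" using close[of i j] N by argo
      then show ?thesis using r by (simp add: dist_norm power2_less_imp_less)
    qed
    then show "\<exists>M. \<forall>m\<ge>M. \<forall>n\<ge>M. dist (X m) (X n) < r" by blast
  qed
  then obtain z where z: "X \<longlonglongrightarrow> z" using Cauchy_convergent convergentD by blast
  have "(\<lambda>n. J (X n)) \<longlonglongrightarrow> J z"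
    unfolding J_def by (intro tendsto_intros z F.tendsto) auto
  moreover have "(\<lambda>n. m + inverse (real (Suc n))) \<longlonglongrightarrow> m + 0"
    by (intro tendsto_intros LIMSEQ_inverse_real_of_nat)
  ultimately have "J z \<le> m + 0"
    by (rule LIMSEQ_le) (use X less_imp_le in blast)
  then have min: "J z \<le> J x" for x using m_le[of x] by simp
  have "F y = inner z y" for y
  proof (cases "y = 0")
    case False
    define d where "d = F y - inner z y"
    define t where "t = d / (norm y)\<^sup>2"
    have n: "(norm y)\<^sup>2 > 0" using False by simp
    have "(norm (z + t *\<^sub>R y))\<^sup>2 = (norm z)\<^sup>2 + 2 * (t * inner z y) + t\<^sup>2 * (norm y)\<^sup>2"
      unfolding power2_norm_eq_inner
      by (simp add: inner_add_left inner_add_right inner_commute power2_eq_square[of t] field_simps)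
    then have "J (z + t *\<^sub>R y) = J z - t * d + t\<^sup>2 * (norm y)\<^sup>2 / 2"
      by (simp add: J_def d_def F.add F.scaleR field_simps)
    also have "\<dots> = J z - d\<^sup>2 / (norm y)\<^sup>2 / 2"
      using n by (simp add: t_def power2_eq_square divide_simps)
    finally have "d\<^sup>2 / (norm y)\<^sup>2 \<le> 0" using min[of "z + t *\<^sub>R y"] by simp
    then have "d = 0" using n by (simp add: divide_le_0_iff)
    then show ?thesis by (simp add: d_def)
  qed simp
  then show thesis by (rule that)
qed

lemma bopD: "T \<in> bop \<Longrightarrow> blinfun_apply T (c *\<^sub>C x) = c *\<^sub>C blinfun_apply T x"
  by (simp add: bop_def)

lemma adj_unique:
  assumes "\<And>x y. cinner (blinfun_apply S x) y = cinner x (blinfun_apply T y)"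
  shows "adj T = S"
  unfolding adj_def
proof (rule the_equality)
  show "\<forall>x y. cinner (blinfun_apply S x) y = cinner x (blinfun_apply T y)"
    using assms by blast
  fix S' assume "\<forall>x y. cinner (blinfun_apply S' x) y = cinner x (blinfun_apply T y)"
  then have "cinner y (blinfun_apply S' x) = cinner y (blinfun_apply S x)" for x y
    using assms by (metis cinner_commute)
  then show "S' = S" by (intro blinfun_eqI cinner_ext)
qed

text \<open>The Riesz theorem gives the adjoint for the real inner product; as \<open>T\<close> commutes with
  multiplication by \<open>\<i>\<close>, it is the adjoint for the complex one, too.\<close>

lemma cinner_adj_left:
  fixes T :: "'h::chilbert_space operator"
  assumes T: "T \<in> bop"
  shows "cinner (blinfun_apply (adj T) x) y = cinner x (blinfun_apply T y)"
proof -
  have "\<exists>z. \<forall>y. inner x (blinfun_apply T y) = inner z y" for x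
  proof -
    have "bounded_linear (\<lambda>y. inner x (blinfun_apply T y))"
      by (intro bounded_linear_compose[OF bounded_linear_inner_right] blinfun.bounded_linear_right)
    from riesz_representation[OF this] show ?thesis by metis
  qed
  then obtain S where S: "\<And>x y. inner x (blinfun_apply T y) = inner (S x) y" by metis
  have "bounded_linear S"
  proof (rule bounded_linear_intro)
    show "S (x + y) = S x + S y" for x y
      using S by (intro vector_eq_ldot[THEN iffD1]) (metis inner_add_left inner_commute)
    show "S (r *\<^sub>R x) = r *\<^sub>R S x" for r x
      using S by (intro vector_eq_ldot[THEN iffD1]) (metis inner_scaleR_left inner_commute)
    show "norm (S x) \<le> norm x * norm T" for x
    proof -
      have "norm (S x) * norm (S x) = inner x (blinfun_apply T (S x))"
        by (simp add: S power2_norm_eq_inner flip: power2_eq_square)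
      also have "\<dots> \<le> norm x * norm (blinfun_apply T (S x))" by (rule norm_cauchy_schwarz)
      also have "\<dots> \<le> norm x * (norm T * norm (S x))"
        by (intro mult_left_mono norm_blinfun) simp
      finally show ?thesis by (cases "norm (S x) = 0") (auto simp: mult.assoc[symmetric])
    qed
  qed
  then have ap: "blinfun_apply (Blinfun S) x = S x" for x by (simp add: bounded_linear_Blinfun_apply)
  have *: "cinner (blinfun_apply (Blinfun S) x) y = cinner x (blinfun_apply T y)" for x y
    by (simp add: complex_eq_iff Re_cinner Im_cinner ap S[symmetric] bopD[OF T, symmetric])
  then show ?thesis using adj_unique[OF *] by simp
qed

lemma cinner_adj_right:
  "T \<in> bop \<Longrightarrow> cinner x (blinfun_apply (adj T) y) = cinner (blinfun_apply T x) y"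
  by (metis cinner_adj_left cinner_commute)

lemma adj_in_bop: "T \<in> bop \<Longrightarrow> adj T \<in> bop"
  unfolding bop_def mem_Collect_eq
  by (intro allI cinner_ext) (simp add: cinner_adj_right bop_def cinner_scaleC_right)

section \<open>The algebra of bounded operators\<close>

lemma op_scale_apply [simp]: "blinfun_apply (op_scale c T) x = c *\<^sub>C blinfun_apply T x"
proof -
  have "bounded_linear (\<lambda>x. c *\<^sub>C blinfun_apply T x)"
  proof (rule bounded_linear_intro)
    show "c *\<^sub>C blinfun_apply T (x + y) = c *\<^sub>C blinfun_apply T x + c *\<^sub>C blinfun_apply T y" for x y
      by (simp add: blinfun.add_right scaleC_add_right)
    show "c *\<^sub>C blinfun_apply T (r *\<^sub>R x) = r *\<^sub>R (c *\<^sub>C blinfun_apply T x)" for r x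
      unfolding blinfun.scaleR_right
      by (simp only: scaleC_of_real[symmetric] scaleC_scaleC mult.commute)
    show "norm (c *\<^sub>C blinfun_apply T x) \<le> norm x * (cmod c * norm T)" for x
      using mult_left_mono[OF norm_blinfun[of T x], of "cmod c"]
      by (simp add: norm_scaleC mult_ac)
  qed
  then show ?thesis by (simp add: op_scale_def bounded_linear_Blinfun_apply)
qed

lemma compose_add_right: "R o\<^sub>L (S + T) = (R o\<^sub>L S) + (R o\<^sub>L (T :: 'h::chilbert_space operator))"
  and compose_add_left: "(S + T) o\<^sub>L R = (S o\<^sub>L R) + (T o\<^sub>L (R :: 'h::chilbert_space operator))"
  and compose_assoc: "(R o\<^sub>L S) o\<^sub>L T = R o\<^sub>L (S o\<^sub>L (T :: 'h::chilbert_space operator))"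
  by (rule blinfun_eqI, simp add: blinfun.add_left blinfun.add_right)+

lemma compose_id [simp]: "id_blinfun o\<^sub>L T = T" "T o\<^sub>L id_blinfun = T"
  by (rule blinfun_eqI, simp)+

lemma bop_zero: "0 \<in> bop" by (simp add: bop_def)
lemma bop_id: "id_blinfun \<in> bop" by (simp add: bop_def)
lemma bop_add: "S \<in> bop \<Longrightarrow> T \<in> bop \<Longrightarrow> S + T \<in> bop"
  by (simp add: bop_def blinfun.add_left scaleC_add_right)
lemma bop_compose: "S \<in> bop \<Longrightarrow> T \<in> bop \<Longrightarrow> S o\<^sub>L T \<in> bop"
  by (simp add: bop_def)
lemma bop_scale: "T \<in> bop \<Longrightarrow> op_scale c T \<in> bop"
  by (simp add: bop_def scaleC_scaleC mult.commute)

lemma subalgebra_bop: "subalgebra bop"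
  by (simp add: subalgebra_def bop_zero bop_add bop_compose bop_scale)

lemma subalgebraD:
  assumes "subalgebra M"
  shows "T \<in> M \<Longrightarrow> T \<in> bop" "0 \<in> M" "S \<in> M \<Longrightarrow> T \<in> M \<Longrightarrow> S + T \<in> M"
    "S \<in> M \<Longrightarrow> T \<in> M \<Longrightarrow> S o\<^sub>L T \<in> M" "T \<in> M \<Longrightarrow> op_scale c T \<in> M"
  using assms by (auto simp: subalgebra_def)

lemma subalgebra_sum:
  "subalgebra M \<Longrightarrow> (\<And>i. i \<in> I \<Longrightarrow> T i \<in> M) \<Longrightarrow> (\<Sum>i\<in>I. T i) \<in> M"
  by (induction I rule: infinite_finite_induct) (auto simp: subalgebraD)

lemma adj_add: "S \<in> bop \<Longrightarrow> T \<in> bop \<Longrightarrow> adj (S + T) = adj S + adj T"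
  by (rule adj_unique)
    (simp add: cinner_adj_left blinfun.add_left cinner_add_left cinner_add_right)
lemma adj_compose: "S \<in> bop \<Longrightarrow> T \<in> bop \<Longrightarrow> adj (S o\<^sub>L T) = adj T o\<^sub>L adj S"
  by (rule adj_unique) (simp add: cinner_adj_left)
lemma adj_scale: "T \<in> bop \<Longrightarrow> adj (op_scale c T) = op_scale (cnj c) (adj T)"
  by (rule adj_unique) (simp add: cinner_adj_left cinner_scaleC_left cinner_scaleC_right)
lemma adj_zero: "adj 0 = 0"
  by (rule adj_unique) simp
lemma adj_id: "adj id_blinfun = id_blinfun"
  by (rule adj_unique) simp
lemma adj_adj: "T \<in> bop \<Longrightarrow> adj (adj T) = T"
  by (rule adj_unique) (simp add: cinner_adj_right)

section \<open>Tensor products of operators\<close>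

lift_definition ket :: "'i \<Rightarrow> 'i ell2" is "\<lambda>i j. if j = i then 1 else 0"
  subgoal for i by (rule finite_nonzero_values_imp_summable_on) (rule finite_subset[of _ "{i}"], auto)
  done

lemma coord_ket: "coord (ket i) j = (if j = i then 1 else 0)"
  by (simp add: ket.rep_eq)

lemma cinner_ell2_infsum: "cinner x y = (\<Sum>\<^sub>\<infinity>i. cnj (coord x i) * coord y i)"
  by (simp add: cinner_ell2_def ell2_cinner_def)

lemma cinner_ket: "cinner (ket i) x = coord x i"
proof -
  have "cinner (ket i) x = (\<Sum>\<^sub>\<infinity>j\<in>{i}. coord x j)"
    unfolding cinner_ell2_infsum by (rule infsum_cong_neutral) (auto simp: coord_ket)
  then show ?thesis by simp
qed

lemma coord_scaleC [simp]: "coord (c *\<^sub>C x) i = c * coord x i"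
  by (simp add: scaleC_ell2_def)

lemma coord_scaleR [simp]: "coord (r *\<^sub>R x) i = complex_of_real r * coord x i"
  by (simp add: scaleR_ell2_def)

lemma coord_sum: "coord (\<Sum>k\<in>K. x k) i = (\<Sum>k\<in>K. coord (x k) i)"
  by (simp flip: cinner_ket add: cinner_sum_right)

lemma coord_adj: "T \<in> bop \<Longrightarrow> coord (blinfun_apply (adj T) x) i = cinner (blinfun_apply T (ket i)) x"
  by (simp flip: cinner_ket add: cinner_adj_right)

lemma coord_tensor_vec: "coord (v \<otimes>\<^sub>v w) (i, j) = coord v i * coord w j"
  by (simp add: tensor_vec.rep_eq)

lemma ket_pair: "ket (i, j) = ket i \<otimes>\<^sub>v ket j"
  by (rule ell2_eqI) (auto simp: coord_ket tensor_vec.rep_eq split: prod.splits)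

lemma cinner_tensor_vec: "cinner (v \<otimes>\<^sub>v w) (v' \<otimes>\<^sub>v w') = cinner v v' * cinner w w'"
proof -
  let ?h = "\<lambda>i j. cnj (coord (v \<otimes>\<^sub>v w) (i, j)) * coord (v' \<otimes>\<^sub>v w') (i, j)"
  have "(\<lambda>(i, j). ?h i j) summable_on (UNIV \<times> UNIV)"
    using coord_mult_summable[of "v \<otimes>\<^sub>v w" "v' \<otimes>\<^sub>v w'"] by (simp add: case_prod_unfold)
  from infsum_Sigma'_banach[OF this]
  have "cinner (v \<otimes>\<^sub>v w) (v' \<otimes>\<^sub>v w') = (\<Sum>\<^sub>\<infinity>i. \<Sum>\<^sub>\<infinity>j. ?h i j)"
    by (simp add: cinner_ell2_infsum case_prod_unfold)
  also have "\<dots> = (\<Sum>\<^sub>\<infinity>i. cnj (coord v i) * coord v' i * cinner w w')"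
  proof (rule infsum_cong)
    fix i
    have "(\<Sum>\<^sub>\<infinity>j. ?h i j) = (\<Sum>\<^sub>\<infinity>j. (cnj (coord v i) * coord v' i) * (cnj (coord w j) * coord w' j))"
      by (simp add: coord_tensor_vec mult_ac)
    also have "\<dots> = (cnj (coord v i) * coord v' i) * cinner w w'"
      unfolding cinner_ell2_infsum by (rule infsum_cmult_right) (rule coord_mult_summable)
    finally show "(\<Sum>\<^sub>\<infinity>j. ?h i j) = cnj (coord v i) * coord v' i * cinner w w'" .
  qed
  also have "\<dots> = cinner v v' * cinner w w'"
    unfolding cinner_ell2_infsum[of v v'] by (rule infsum_cmult_left) (rule coord_mult_summable)
  finally show ?thesis .
qed

text \<open>The values on the basis vectors are the rows of the adjoint, hence determine it.\<close>

lemma ell2_operator_eqI: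
  assumes "S \<in> bop" "T \<in> bop" "\<And>i. blinfun_apply S (ket i) = blinfun_apply T (ket i)"
  shows "S = T"
proof -
  have "adj S = adj T"
    by (intro blinfun_eqI ell2_eqI) (simp add: coord_adj assms)
  then show ?thesis by (metis adj_adj assms(1,2))
qed

lemma tensor_operator_eqI:
  assumes "S \<in> bop" "T \<in> bop"
    "\<And>v w. blinfun_apply S (v \<otimes>\<^sub>v w) = blinfun_apply T (v \<otimes>\<^sub>v w)"
  shows "S = T"
proof (rule ell2_operator_eqI[OF assms(1,2)])
  show "blinfun_apply S (ket k) = blinfun_apply T (ket k)" for k
    by (cases k) (simp add: ket_pair assms(3))
qed

lemma has_sum_finite_sum:
  fixes F :: "'j \<Rightarrow> 'i \<Rightarrow> real"
  assumes "finite J" "\<And>j. j \<in> J \<Longrightarrow> F j summable_on A"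
  shows "((\<lambda>i. \<Sum>j\<in>J. F j i) has_sum (\<Sum>j\<in>J. infsum (F j) A)) A"
  using assms by (induction J rule: finite_induct) (simp_all add: has_sum_add)

text \<open>An operator acts on each fibre of an index set that is, along a bijection, a product.
  Boundedness is checked on finite boxes: on each fibre the square norm grows by at most
  \<open>(norm S)\<^sup>2\<close>, and the square norms of the fibres of \<open>x\<close> add up to at most that of \<open>x\<close>.\<close>

lemma fibrewise_operator:
  fixes S :: "'i ell2 operator" and f :: "'i \<Rightarrow> 'j \<Rightarrow> 'k"
  assumes S: "S \<in> bop" and f: "bij (case_prod f)"
  obtains R where "R \<in> bop"
    "\<And>x i j y. (\<And>i. coord y i = coord x (f i j)) \<Longrightarrow>
      coord (blinfun_apply R x) (f i j) = coord (blinfun_apply S y) i"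
proof -
  have inj: "f i j = f i' j' \<longleftrightarrow> i = i' \<and> j = j'" for i j i' j'
    using bij_is_inj[OF f] by (auto dest: injD[of _ "(i, j)" "(i', j')"])
  have fib_summable: "(\<lambda>i. (cmod (coord x (f i j)))\<^sup>2) summable_on UNIV" for x :: "'k ell2" and j
  proof -
    have "(\<lambda>k. (cmod (coord x k))\<^sup>2) summable_on (\<lambda>i. f i j) ` UNIV"
      by (rule summable_on_subset_banach[OF coord_sq_summable]) simp
    then show ?thesis
      by (subst (asm) summable_on_reindex) (auto simp: inj_on_def inj comp_def)
  qed
  define fib where "fib x j = Abs_ell2 (\<lambda>i. coord x (f i j))" for x :: "'k ell2" and j
  have cfib: "coord (fib x j) i = coord x (f i j)" for x j i
    by (simp add: fib_def Abs_ell2_inverse fib_summable)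
  have fib_norm: "(\<Sum>j\<in>J. (norm (fib x j))\<^sup>2) \<le> (norm x)\<^sup>2" if J: "finite J" for x J
  proof -
    have "(\<Sum>j\<in>J. (norm (fib x j))\<^sup>2) = (\<Sum>\<^sub>\<infinity>i. \<Sum>j\<in>J. (cmod (coord x (f i j)))\<^sup>2)"
      unfolding ell2_sq_norm cfib
      by (rule infsumI[symmetric], rule has_sum_finite_sum[OF J], rule fib_summable)
    also have "\<dots> \<le> (norm x)\<^sup>2"
    proof (rule infsum_le_finite_sums)
      show "(\<lambda>i. \<Sum>j\<in>J. (cmod (coord x (f i j)))\<^sup>2) summable_on UNIV"
        by (rule has_sum_imp_summable, rule has_sum_finite_sum[OF J], rule fib_summable)
      fix I :: "'i set" assume I: "finite I"
      have "(\<Sum>i\<in>I. \<Sum>j\<in>J. (cmod (coord x (f i j)))\<^sup>2)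
          = (\<Sum>k\<in>case_prod f ` (I \<times> J). (cmod (coord x k))\<^sup>2)"
        by (subst sum.reindex) (auto simp: inj_on_def inj sum.cartesian_product case_prod_unfold)
      also have "\<dots> \<le> (norm x)\<^sup>2" by (rule ell2_sum_le_norm) (use I J in simp)
      finally show "(\<Sum>i\<in>I. \<Sum>j\<in>J. (cmod (coord x (f i j)))\<^sup>2) \<le> (norm x)\<^sup>2" .
    qed
    finally show ?thesis .
  qed
  define g where "g x k = (case inv (case_prod f) k of (i, j) \<Rightarrow> coord (blinfun_apply S (fib x j)) i)"
    for x k
  have gf: "g x (f i j) = coord (blinfun_apply S (fib x j)) i" for x i j
    using inv_f_f[OF bij_is_inj[OF f], of "(i, j)"] by (simp add: g_def)
  have g_sum: "(\<Sum>k\<in>G. (cmod (g x k))\<^sup>2) \<le> (norm S * norm x)\<^sup>2" if G: "finite G" for x G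
  proof -
    define I where "I = fst ` inv (case_prod f) ` G"
    define J where "J = snd ` inv (case_prod f) ` G"
    have fin: "finite I" "finite J" using G by (auto simp: I_def J_def)
    have "G \<subseteq> case_prod f ` (I \<times> J)"
    proof
      fix k assume "k \<in> G"
      then have "inv (case_prod f) k \<in> I \<times> J"
        by (auto simp: I_def J_def mem_Times_iff)
      then show "k \<in> case_prod f ` (I \<times> J)"
        using surj_f_inv_f[OF bij_is_surj[OF f], of k] by (metis image_eqI)
    qed
    then have "(\<Sum>k\<in>G. (cmod (g x k))\<^sup>2) \<le> (\<Sum>k\<in>case_prod f ` (I \<times> J). (cmod (g x k))\<^sup>2)"
      by (intro sum_mono2) (use fin in auto)
    also have "\<dots> = (\<Sum>i\<in>I. \<Sum>j\<in>J. (cmod (coord (blinfun_apply S (fib x j)) i))\<^sup>2)"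
      by (subst sum.reindex) (auto simp: inj_on_def inj gf sum.cartesian_product case_prod_unfold)
    also have "\<dots> = (\<Sum>j\<in>J. \<Sum>i\<in>I. (cmod (coord (blinfun_apply S (fib x j)) i))\<^sup>2)"
      by (rule sum.swap)
    also have "\<dots> \<le> (\<Sum>j\<in>J. (norm (blinfun_apply S (fib x j)))\<^sup>2)"
      by (intro sum_mono ell2_sum_le_norm fin)
    also have "\<dots> \<le> (\<Sum>j\<in>J. (norm S)\<^sup>2 * (norm (fib x j))\<^sup>2)"
      unfolding power_mult_distrib[symmetric] by (intro sum_mono power_mono norm_blinfun) simp
    also have "\<dots> \<le> (norm S)\<^sup>2 * (norm x)\<^sup>2"
      unfolding sum_distrib_left[symmetric] by (intro mult_left_mono fib_norm fin) simp
    finally show ?thesis by (simp add: power_mult_distrib)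
  qed
  have g_summable: "(\<lambda>k. (cmod (g x k))\<^sup>2) summable_on UNIV" for x
    by (rule nonneg_bdd_above_summable_on) (auto intro!: bdd_aboveI2 g_sum)
  define h where "h x = Abs_ell2 (g x)" for x
  have ch: "coord (h x) k = g x k" for x k
    by (simp add: h_def Abs_ell2_inverse g_summable)
  have h_eqI: "h x = y" if "\<And>i j. coord (blinfun_apply S (fib x j)) i = coord y (f i j)" for x y
  proof (rule ell2_eqI)
    fix k
    obtain i j where "k = f i j" using bij_is_surj[OF f] by (metis surjD case_prod_unfold)
    then show "coord (h x) k = coord y k" by (simp add: ch gf that)
  qed
  have fib_add: "fib (x + y) j = fib x j + fib y j" for x y j
    by (rule ell2_eqI) (simp add: cfib)
  have fib_scaleC: "fib (c *\<^sub>C x) j = c *\<^sub>C fib x j" for c x j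
    by (rule ell2_eqI) (simp add: cfib)
  have h_add: "h (x + y) = h x + h y" for x y
    by (rule h_eqI) (simp add: fib_add blinfun.add_right ch gf)
  have h_scaleC: "h (c *\<^sub>C x) = c *\<^sub>C h x" for c x
    by (rule h_eqI) (simp add: fib_scaleC bopD[OF S] ch gf)
  have "bounded_linear h"
  proof (rule bounded_linear_intro)
    show "h (x + y) = h x + h y" for x y by (rule h_add)
    show "h (r *\<^sub>R x) = r *\<^sub>R h x" for r x by (simp add: h_scaleC flip: scaleC_of_real)
    show "norm (h x) \<le> norm x * norm S" for x
    proof (rule power2_le_imp_le)
      show "(norm (h x))\<^sup>2 \<le> (norm x * norm S)\<^sup>2"
        unfolding ell2_sq_norm ch
        mult.commute[of "norm x"] by (rule infsum_le_finite_sums[OF g_summable]) (rule g_sum)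
    qed simp
  qed
  then have ap: "blinfun_apply (Blinfun h) x = h x" for x by (simp add: bounded_linear_Blinfun_apply)
  show thesis
  proof (rule that[of "Blinfun h"])
    show "Blinfun h \<in> bop" by (simp add: bop_def ap h_scaleC)
    fix x i j y assume "\<And>i. coord y i = coord x (f i j)"
    then have "y = fib x j" by (intro ell2_eqI) (simp add: cfib)
    then show "coord (blinfun_apply (Blinfun h) x) (f i j) = coord (blinfun_apply S y) i"
      by (simp add: ap ch gf)
  qed
qed

text \<open>\<open>S \<otimes>\<^sub>o T\<close> is the composition of \<open>S\<close>, acting on the fibres with constant second index, and
  \<open>T\<close>, acting on the fibres with constant first index.\<close>

lemma tensor_op:
  fixes S :: "'i ell2 operator" and T :: "'j ell2 operator"
  assumes S: "S \<in> bop" and T: "T \<in> bop"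
  shows tensor_op_in_bop: "S \<otimes>\<^sub>o T \<in> bop"
    and tensor_op_apply:
      "blinfun_apply (S \<otimes>\<^sub>o T) (v \<otimes>\<^sub>v w) = blinfun_apply S v \<otimes>\<^sub>v blinfun_apply T w"
proof -
  obtain S1 :: "('i \<times> 'j) ell2 operator" where S1: "S1 \<in> bop"
    "\<And>x i j y. (\<And>i. coord y i = coord x (i, j)) \<Longrightarrow>
      coord (blinfun_apply S1 x) (i, j) = coord (blinfun_apply S y) i"
    using fibrewise_operator[OF S, of Pair] by auto
  have "bij (\<lambda>(j, i). (i, j))"
    by (rule bijI) (auto simp: inj_def surj_def)
  then obtain T1 :: "('i \<times> 'j) ell2 operator" where T1: "T1 \<in> bop"
    "\<And>x j i y. (\<And>j. coord y j = coord x (i, j)) \<Longrightarrow>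
      coord (blinfun_apply T1 x) (i, j) = coord (blinfun_apply T y) j"
    using fibrewise_operator[OF T, of "\<lambda>j i. (i, j)"] by auto
  have aS: "blinfun_apply S1 (v \<otimes>\<^sub>v w) = blinfun_apply S v \<otimes>\<^sub>v w" for v w
  proof (rule ell2_eqI)
    fix k :: "'i \<times> 'j"
    obtain i j where k: "k = (i, j)" by (cases k)
    have "coord (blinfun_apply S1 (v \<otimes>\<^sub>v w)) (i, j) = coord (blinfun_apply S (coord w j *\<^sub>C v)) i"
      by (rule S1(2)) (simp add: coord_tensor_vec)
    then show "coord (blinfun_apply S1 (v \<otimes>\<^sub>v w)) k = coord (blinfun_apply S v \<otimes>\<^sub>v w) k"
      by (simp add: k coord_tensor_vec bopD[OF S])
  qed
  have aT: "blinfun_apply T1 (v \<otimes>\<^sub>v w) = v \<otimes>\<^sub>v blinfun_apply T w" for v w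
  proof (rule ell2_eqI)
    fix k :: "'i \<times> 'j"
    obtain i j where k: "k = (i, j)" by (cases k)
    have "coord (blinfun_apply T1 (v \<otimes>\<^sub>v w)) (i, j) = coord (blinfun_apply T (coord v i *\<^sub>C w)) j"
      by (rule T1(2)) (simp add: coord_tensor_vec)
    then show "coord (blinfun_apply T1 (v \<otimes>\<^sub>v w)) k = coord (v \<otimes>\<^sub>v blinfun_apply T w) k"
      by (simp add: k coord_tensor_vec bopD[OF T])
  qed
  have "\<exists>!R. R \<in> bop \<and>
      (\<forall>v w. blinfun_apply R (v \<otimes>\<^sub>v w) = blinfun_apply S v \<otimes>\<^sub>v blinfun_apply T w)"
  proof (rule ex1I[of _ "S1 o\<^sub>L T1"])
    show *: "S1 o\<^sub>L T1 \<in> bop \<and>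
        (\<forall>v w. blinfun_apply (S1 o\<^sub>L T1) (v \<otimes>\<^sub>v w) = blinfun_apply S v \<otimes>\<^sub>v blinfun_apply T w)"
      by (simp add: bop_compose S1 T1 aS aT)
    show "R = S1 o\<^sub>L T1" if "R \<in> bop \<and>
        (\<forall>v w. blinfun_apply R (v \<otimes>\<^sub>v w) = blinfun_apply S v \<otimes>\<^sub>v blinfun_apply T w)" for R
      using that * by (intro tensor_operator_eqI) auto
  qed
  from theI'[OF this] show "S \<otimes>\<^sub>o T \<in> bop"
    "blinfun_apply (S \<otimes>\<^sub>o T) (v \<otimes>\<^sub>v w) = blinfun_apply S v \<otimes>\<^sub>v blinfun_apply T w"
    by (simp_all add: tensor_op_def)
qed

lemma tensor_op_eqI:
  assumes "S \<in> bop" "T \<in> bop" "R \<in> bop"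
    "\<And>v w. blinfun_apply R (v \<otimes>\<^sub>v w) = blinfun_apply S v \<otimes>\<^sub>v blinfun_apply T w"
  shows "S \<otimes>\<^sub>o T = R"
  by (rule tensor_operator_eqI) (simp_all add: assms tensor_op)

lemma tensor_vec_simps:
  "(v + v') \<otimes>\<^sub>v w = v \<otimes>\<^sub>v w + v' \<otimes>\<^sub>v w" "v \<otimes>\<^sub>v (w + w') = v \<otimes>\<^sub>v w + v \<otimes>\<^sub>v w'"
  "(c *\<^sub>C v) \<otimes>\<^sub>v w = c *\<^sub>C (v \<otimes>\<^sub>v w)" "0 \<otimes>\<^sub>v w = 0" "v \<otimes>\<^sub>v 0 = 0"
  by (rule ell2_eqI, clarsimp simp: coord_tensor_vec algebra_simps)+

lemma tensor_op_id: "id_blinfun \<otimes>\<^sub>o id_blinfun = id_blinfun"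
  by (rule tensor_op_eqI) (simp_all add: bop_id)
lemma tensor_op_zero_left: "T \<in> bop \<Longrightarrow> 0 \<otimes>\<^sub>o T = 0"
  by (rule tensor_op_eqI) (simp_all add: bop_zero tensor_vec_simps)
lemma tensor_op_zero_right: "T \<in> bop \<Longrightarrow> T \<otimes>\<^sub>o 0 = 0"
  by (rule tensor_op_eqI) (simp_all add: bop_zero tensor_vec_simps)
lemma tensor_op_add_left:
  "S \<in> bop \<Longrightarrow> S' \<in> bop \<Longrightarrow> T \<in> bop \<Longrightarrow> (S + S') \<otimes>\<^sub>o T = S \<otimes>\<^sub>o T + S' \<otimes>\<^sub>o T"
  by (rule tensor_op_eqI) (simp_all add: bop_add tensor_op blinfun.add_left tensor_vec_simps)
lemma tensor_op_add_right:
  "S \<in> bop \<Longrightarrow> T \<in> bop \<Longrightarrow> T' \<in> bop \<Longrightarrow> S \<otimes>\<^sub>o (T + T') = S \<otimes>\<^sub>o T + S \<otimes>\<^sub>o T'"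
  by (rule tensor_op_eqI) (simp_all add: bop_add tensor_op blinfun.add_left tensor_vec_simps)
lemma tensor_op_scale: "S \<in> bop \<Longrightarrow> T \<in> bop \<Longrightarrow> op_scale c S \<otimes>\<^sub>o T = op_scale c (S \<otimes>\<^sub>o T)"
  by (rule tensor_op_eqI) (simp_all add: bop_scale tensor_op tensor_vec_simps)
lemma tensor_op_compose:
  "S \<in> bop \<Longrightarrow> S' \<in> bop \<Longrightarrow> T \<in> bop \<Longrightarrow> T' \<in> bop \<Longrightarrow>
    (S \<otimes>\<^sub>o T) o\<^sub>L (S' \<otimes>\<^sub>o T') = (S o\<^sub>L S') \<otimes>\<^sub>o (T o\<^sub>L T')"
  by (rule tensor_op_eqI[symmetric]) (simp_all add: bop_compose tensor_op)

lemma adj_tensor_op: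
  assumes "S \<in> bop" "T \<in> bop"
  shows "adj (S \<otimes>\<^sub>o T) = adj S \<otimes>\<^sub>o adj T"
proof (rule tensor_op_eqI[symmetric])
  show "blinfun_apply (adj (S \<otimes>\<^sub>o T)) (v \<otimes>\<^sub>v w)
      = blinfun_apply (adj S) v \<otimes>\<^sub>v blinfun_apply (adj T) w" for v w
  proof (rule ell2_eqI)
    fix k
    show "coord (blinfun_apply (adj (S \<otimes>\<^sub>o T)) (v \<otimes>\<^sub>v w)) k
        = coord (blinfun_apply (adj S) v \<otimes>\<^sub>v blinfun_apply (adj T) w) k"
      by (cases k) (simp add: assms coord_adj tensor_op ket_pair cinner_tensor_vec coord_tensor_vec)
  qed
qed (simp_all add: assms adj_in_bop tensor_op)

section \<open>Perfect strategies with two questions and two answers for Alice are classical\<close>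

text \<open>A perfect strategy in terms of the real inner product: the probabilities are real, and a
  projection is symmetric for the real part of the complex inner product as well.\<close>

locale imitation_strategy =
  fixes X :: "'x set" and Y :: "'y set" and A :: "'a set" and B :: "'b set"
    and \<Lambda> :: "'x \<Rightarrow> 'y \<Rightarrow> 'a \<Rightarrow> 'b \<Rightarrow> nat"
    and P :: "'x \<Rightarrow> 'a \<Rightarrow> 'v::real_inner \<Rightarrow> 'v" and Q :: "'y \<Rightarrow> 'b \<Rightarrow> 'v \<Rightarrow> 'v" and \<psi> :: 'v
  assumes game: "imitation_game X Y A B \<Lambda>"
    and card_A: "card A = 2"
    and P_linear: "\<And>x a. x \<in> X \<Longrightarrow> a \<in> A \<Longrightarrow> linear (P x a)"
    and P_sym: "\<And>x a u v. x \<in> X \<Longrightarrow> a \<in> A \<Longrightarrow> inner (P x a u) v = inner u (P x a v)"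
    and P_idem: "\<And>x a u. x \<in> X \<Longrightarrow> a \<in> A \<Longrightarrow> P x a (P x a u) = P x a u"
    and P_sum: "\<And>x u. x \<in> X \<Longrightarrow> (\<Sum>a\<in>A. P x a u) = u"
    and Q_sym: "\<And>y b u v. y \<in> Y \<Longrightarrow> b \<in> B \<Longrightarrow> inner (Q y b u) v = inner u (Q y b v)"
    and Q_idem: "\<And>y b u. y \<in> Y \<Longrightarrow> b \<in> B \<Longrightarrow> Q y b (Q y b u) = Q y b u"
    and Q_sum: "\<And>y u. y \<in> Y \<Longrightarrow> (\<Sum>b\<in>B. Q y b u) = u"
    and PQ_commute: "\<And>x y a b u. x \<in> X \<Longrightarrow> y \<in> Y \<Longrightarrow> a \<in> A \<Longrightarrow> b \<in> B \<Longrightarrow>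
      P x a (Q y b u) = Q y b (P x a u)"
    and \<psi>_unit: "norm \<psi> = 1"
    and strategy_perfect: "\<And>x y a b. x \<in> X \<Longrightarrow> y \<in> Y \<Longrightarrow> a \<in> A \<Longrightarrow> b \<in> B \<Longrightarrow>
      \<Lambda> x y a b = 0 \<Longrightarrow> P x a (Q y b \<psi>) = 0"
begin

lemma finite_A: "finite A" and finite_B: "finite B"
  using game by (simp_all add: imitation_game_def nonlocal_game_def)

lemma other_answer:
  assumes "a \<in> A"
  obtains a' where "a' \<in> A" "a' \<noteq> a" "A = {a, a'}"
proof -
  obtain u v where "A = {u, v}" "u \<noteq> v" using card_A by (meson card_2_iff)
  then show thesis using assms that[of u] that[of v] by (auto simp: insert_commute)
qed

lemmas P_simps = linear_0[OF P_linear] linear_add[OF P_linear] linear_diff[OF P_linear]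
  linear_sum[OF P_linear]

lemma separated_answers_Alice:
  assumes "x \<in> X" "a \<in> A" "a' \<in> A" "a \<noteq> a'"
  obtains y where "y \<in> Y" "\<And>b. b \<in> B \<Longrightarrow> \<Lambda> x y a b = 0 \<or> \<Lambda> x y a' b = 0"
proof -
  obtain y where "y \<in> Y" "(\<Sum>b\<in>B. \<Lambda> x y a b * \<Lambda> x y a' b) = 0"
    using game assms unfolding imitation_game_def by blast
  then show thesis using that[of y] finite_B by simp
qed

lemma separated_answers_Bob:
  assumes "y \<in> Y" "b \<in> B" "b' \<in> B" "b \<noteq> b'"
  obtains x where "x \<in> X" "\<And>a. a \<in> A \<Longrightarrow> \<Lambda> x y a b = 0 \<or> \<Lambda> x y a b' = 0"
proof -
  have "\<exists>x\<in>X. (\<Sum>a\<in>A. \<Lambda> x y a b * \<Lambda> x y a b') = 0"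
    using game[unfolded imitation_game_def, THEN conjunct2, THEN conjunct2] assms by blast
  then obtain x where "x \<in> X" "(\<Sum>a\<in>A. \<Lambda> x y a b * \<Lambda> x y a b') = 0" by blast
  then show thesis using that[of x] finite_A by simp
qed

text \<open>On \<open>\<psi>\<close>, a projection of Alice's agrees with one of Bob's, namely with the sum \<open>F\<close> of his
  projections for those answers, to a question separating Alice's two answers, that can win
  together with \<open>a\<close>.  As \<open>F\<close> commutes with Alice's projections, the vector state of \<open>\<psi>\<close> behaves
  like a trace on them.\<close>

lemma norm_P_P:
  assumes x: "x \<in> X" "x' \<in> X" and a: "a \<in> A" and c: "c \<in> A"
  shows "(norm (P x' c (P x a \<psi>)))\<^sup>2 = inner (P x a \<psi>) (P x' c \<psi>)"
proof -
  obtain a' where a': "a' \<in> A" "a' \<noteq> a" "A = {a, a'}" using other_answer[OF a] .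
  obtain y where y: "y \<in> Y" and sep: "\<And>b. b \<in> B \<Longrightarrow> \<Lambda> x y a b = 0 \<or> \<Lambda> x y a' b = 0"
    using separated_answers_Alice[of x a a'] x(1) a a' by metis
  define B1 where "B1 = {b \<in> B. \<Lambda> x y a b \<noteq> 0}"
  define F where "F u = (\<Sum>b\<in>B1. Q y b u)" for u
  have F_sym: "inner (F u) v = inner u (F v)" for u v
    by (simp add: F_def inner_sum_left inner_sum_right Q_sym y B1_def)
  have F_commute: "P z d (F u) = F (P z d u)" if "z \<in> X" "d \<in> A" for z d u
    using that by (simp add: F_def P_simps PQ_commute y B1_def)
  have split: "P x a u + P x a' u = u" for u
    using P_sum[OF x(1), of u] a' by simp
  have "P x a \<psi> = (\<Sum>b\<in>B. P x a (Q y b \<psi>))"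
    using P_simps(4)[OF x(1) a, of "\<lambda>b. Q y b \<psi>" B] Q_sum[OF y] by simp
  also have "\<dots> = (\<Sum>b\<in>B1. P x a (Q y b \<psi>))"
    by (rule sum.mono_neutral_right)
      (auto simp: B1_def finite_B strategy_perfect x y a)
  also have "\<dots> = F \<psi>"
    unfolding F_def
  proof (rule sum.cong)
    fix b assume "b \<in> B1"
    then have "P x a' (Q y b \<psi>) = 0"
      using sep[of b] by (intro strategy_perfect x y a') (auto simp: B1_def)
    then show "P x a (Q y b \<psi>) = Q y b \<psi>" using split[of "Q y b \<psi>"] by simp
  qed simp
  finally have F: "P x a \<psi> = F \<psi>" .
  have "(norm (P x' c (P x a \<psi>)))\<^sup>2 = inner (P x a \<psi>) (P x' c (P x a \<psi>))"
    by (simp add: power2_norm_eq_inner P_sym P_idem x c a)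
  also have "\<dots> = inner (P x a (F \<psi>)) (P x' c \<psi>)"
    using F_commute[OF x(2) c] F_commute[OF x(1) a] by (metis F F_sym)
  also have "\<dots> = inner (P x a \<psi>) (P x' c \<psi>)"
    by (simp add: F[symmetric] P_idem x a)
  finally show ?thesis .
qed

text \<open>Bob's side of a hidden variable model: the hidden variable is a pair \<open>(c, d)\<close> of answers of
  Alice's, to \<open>x\<close> and \<open>x'\<close>, with weight \<open>inner (P x c \<psi>) (P x' d \<psi>)\<close>; Alice answers by the
  component that she is asked for, and Bob answers \<open>g c d\<close>.\<close>

definition classical_response :: "'x \<Rightarrow> 'x \<Rightarrow> 'y \<Rightarrow> ('a \<Rightarrow> 'a \<Rightarrow> 'b) \<Rightarrow> bool" where
  "classical_response x x' y g \<longleftrightarrow> (\<forall>c\<in>A. \<forall>d\<in>A. g c d \<in> B) \<and>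
    (\<forall>b\<in>B. \<forall>c\<in>A. inner \<psi> (P x c (Q y b \<psi>)) =
      (\<Sum>d\<in>A. if g c d = b then inner (P x c \<psi>) (P x' d \<psi>) else 0)) \<and>
    (\<forall>b\<in>B. \<forall>d\<in>A. inner \<psi> (P x' d (Q y b \<psi>)) =
      (\<Sum>c\<in>A. if g c d = b then inner (P x c \<psi>) (P x' d \<psi>) else 0))"

lemma classical_response_swap:
  assumes "classical_response x x' y g"
  shows "classical_response x' x y (\<lambda>d c. g c d)"
proof -
  have "inner (P x' d \<psi>) (P x c \<psi>) = inner (P x c \<psi>) (P x' d \<psi>)" for c d
    by (rule inner_commute)
  then show ?thesis using assms by (simp add: classical_response_def cong: if_cong)
qed

lemma B_nonempty: "y \<in> Y \<Longrightarrow> B \<noteq> {}"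
  using Q_sum[of y \<psi>] \<psi>_unit by auto

text \<open>Each answer \<open>a\<close> to \<open>x\<close> then determines Bob's answer \<open>f a\<close> to \<open>y\<close>: the vector
  \<open>Q y b \<psi>\<close> is the sum of the \<open>P x a \<psi>\<close> with \<open>f a = b\<close>, and Bob can ignore the second
  component of the pair.\<close>

lemma classical_response_if_determined:
  assumes x: "x \<in> X" "x' \<in> X" and y: "y \<in> Y"
    and h: "\<And>a b b'. a \<in> A \<Longrightarrow> b \<in> B \<Longrightarrow> b' \<in> B \<Longrightarrow> b \<noteq> b' \<Longrightarrow>
      P x a (Q y b \<psi>) = 0 \<or> P x a (Q y b' \<psi>) = 0"
  shows "\<exists>g. classical_response x x' y g"
proof -
  obtain b0 where b0: "b0 \<in> B" using B_nonempty[OF y] by blast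
  have "\<exists>b. b \<in> B \<and> (\<forall>b'\<in>B. b' \<noteq> b \<longrightarrow> P x a (Q y b' \<psi>) = 0)" if a: "a \<in> A" for a
    using h[OF a] b0 by blast
  then obtain f where f: "\<And>a. a \<in> A \<Longrightarrow> f a \<in> B"
    "\<And>a b. a \<in> A \<Longrightarrow> b \<in> B \<Longrightarrow> b \<noteq> f a \<Longrightarrow> P x a (Q y b \<psi>) = 0" by metis
  have P_Q: "P x a (Q y b \<psi>) = (if f a = b then P x a \<psi> else 0)" if a: "a \<in> A" and b: "b \<in> B" for a b
  proof -
    have "P x a \<psi> = (\<Sum>b'\<in>B. P x a (Q y b' \<psi>))"
      using P_simps(4)[OF x(1) a, of "\<lambda>b. Q y b \<psi>" B] Q_sum[OF y] by simp
    also have "\<dots> = (\<Sum>b'\<in>{f a}. P x a (Q y b' \<psi>))"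
      by (rule sum.mono_neutral_right) (use a f finite_B in auto)
    finally show ?thesis using f a b by auto
  qed
  have "classical_response x x' y (\<lambda>c d. f c)"
    unfolding classical_response_def
  proof (intro conjI ballI)
    fix b c assume b: "b \<in> B" and c: "c \<in> A"
    have "inner (P x c \<psi>) \<psi> = (\<Sum>d\<in>A. inner (P x c \<psi>) (P x' d \<psi>))"
      by (simp add: inner_sum_right[symmetric] P_sum x)
    then show "inner \<psi> (P x c (Q y b \<psi>))
        = (\<Sum>d\<in>A. if f c = b then inner (P x c \<psi>) (P x' d \<psi>) else 0)"
      by (simp add: P_Q b c inner_commute)
  next
    fix b d assume b: "b \<in> B" and d: "d \<in> A"
    have "Q y b \<psi> = (\<Sum>c\<in>A. if f c = b then P x c \<psi> else 0)"
      using P_sum[OF x(1), of "Q y b \<psi>"] by (simp add: P_Q b cong: sum.cong)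
    then have "inner (P x' d \<psi>) (Q y b \<psi>)
        = (\<Sum>c\<in>A. inner (P x' d \<psi>) (if f c = b then P x c \<psi> else 0))"
      by (simp add: inner_sum_right)
    also have "\<dots> = (\<Sum>c\<in>A. if f c = b then inner (P x c \<psi>) (P x' d \<psi>) else 0)"
      by (rule sum.cong) (auto simp: inner_commute)
    finally show "inner \<psi> (P x' d (Q y b \<psi>)) =
        (\<Sum>c\<in>A. if f c = b then inner (P x c \<psi>) (P x' d \<psi>) else 0)"
      by (simp add: P_sym x d)
  qed (simp add: f)
  then show ?thesis by blast
qed

text \<open>If Alice's projections commute on \<open>\<psi>\<close>, then a pair of answers is a joint measurement outcome;
  at most one answer of Bob's wins against both of its components, because any two of his answers
  are separated by \<open>x\<close> or by \<open>x'\<close>.\<close>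

lemma classical_response_if_commute:
  assumes X: "X = {x, x'}" and y: "y \<in> Y"
    and comm: "\<And>c d. c \<in> A \<Longrightarrow> d \<in> A \<Longrightarrow> P x c (P x' d \<psi>) = P x' d (P x c \<psi>)"
  shows "\<exists>g. classical_response x x' y g"
proof -
  have x: "x \<in> X" "x' \<in> X" using X by auto
  obtain b0 where b0: "b0 \<in> B" using B_nonempty[OF y] by blast
  have "\<exists>b. b \<in> B \<and> (\<forall>b'\<in>B. b' \<noteq> b \<longrightarrow> \<Lambda> x y c b' = 0 \<or> \<Lambda> x' y d b' = 0)"
    if c: "c \<in> A" and d: "d \<in> A" for c d
  proof (cases "\<exists>b\<in>B. \<Lambda> x y c b \<noteq> 0 \<and> \<Lambda> x' y d b \<noteq> 0")
    case True
    then obtain b where b: "b \<in> B" "\<Lambda> x y c b \<noteq> 0" "\<Lambda> x' y d b \<noteq> 0" by blast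
    have "\<Lambda> x y c b' = 0 \<or> \<Lambda> x' y d b' = 0" if b': "b' \<in> B" "b' \<noteq> b" for b'
    proof -
      obtain z where "z \<in> X" and z: "\<forall>a\<in>A. \<Lambda> z y a b = 0 \<or> \<Lambda> z y a b' = 0"
        using separated_answers_Bob[OF y b(1) b'(1) b'(2)[symmetric]] by metis
      then have "z = x \<or> z = x'" using X by blast
      then show ?thesis using z b c d by auto
    qed
    then show ?thesis using b(1) by (intro exI[of _ b]) simp
  qed (use b0 in blast)
  then obtain g where g: "\<And>c d. c \<in> A \<Longrightarrow> d \<in> A \<Longrightarrow> g c d \<in> B"
    "\<And>c d b. c \<in> A \<Longrightarrow> d \<in> A \<Longrightarrow> b \<in> B \<Longrightarrow> b \<noteq> g c d \<Longrightarrow> \<Lambda> x y c b = 0 \<or> \<Lambda> x' y d b = 0"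
    by metis
  have comm_Q: "P x c (P x' d (Q y b \<psi>)) = P x' d (P x c (Q y b \<psi>))"
    if "b \<in> B" "c \<in> A" "d \<in> A" for b c d
    using that comm by (simp add: PQ_commute x y)
  have P_P_Q: "inner \<psi> (P x c (P x' d (Q y b \<psi>)))
      = (if g c d = b then inner (P x c \<psi>) (P x' d \<psi>) else 0)"
    if b: "b \<in> B" and c: "c \<in> A" and d: "d \<in> A" for b c d
  proof -
    have zero: "P x c (P x' d (Q y b' \<psi>)) = 0" if b': "b' \<in> B" "b' \<noteq> g c d" for b'
    proof (cases "\<Lambda> x' y d b' = 0")
      case True
      then show ?thesis by (simp add: strategy_perfect b' c d x y P_simps)
    next
      case False
      then have "\<Lambda> x y c b' = 0" using g(2)[OF c d b'] by simp
      then show ?thesis unfolding comm_Q[OF b'(1) c d]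
        by (simp add: strategy_perfect b' c d x y P_simps)
    qed
    have "P x c (P x' d \<psi>) = P x c (P x' d (\<Sum>b'\<in>B. Q y b' \<psi>))" by (simp add: Q_sum y)
    also have "\<dots> = (\<Sum>b'\<in>B. P x c (P x' d (Q y b' \<psi>)))" by (simp add: P_simps x c d)
    also have "\<dots> = (\<Sum>b'\<in>{g c d}. P x c (P x' d (Q y b' \<psi>)))"
      by (rule sum.mono_neutral_right) (use g c d finite_B zero in auto)
    finally show ?thesis using zero[OF b] by (auto simp: P_sym x c)
  qed
  have "classical_response x x' y g"
    unfolding classical_response_def
  proof (intro conjI ballI)
    fix b c assume b: "b \<in> B" and c: "c \<in> A"
    have "inner \<psi> (P x c (Q y b \<psi>)) = (\<Sum>d\<in>A. inner \<psi> (P x' d (P x c (Q y b \<psi>))))"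
      by (simp add: inner_sum_right[symmetric] P_sum x)
    then show "inner \<psi> (P x c (Q y b \<psi>))
        = (\<Sum>d\<in>A. if g c d = b then inner (P x c \<psi>) (P x' d \<psi>) else 0)"
      by (simp add: comm_Q[symmetric] P_P_Q b c cong: sum.cong)
  next
    fix b d assume b: "b \<in> B" and d: "d \<in> A"
    have "inner \<psi> (P x' d (Q y b \<psi>)) = (\<Sum>c\<in>A. inner \<psi> (P x c (P x' d (Q y b \<psi>))))"
      by (simp add: inner_sum_right[symmetric] P_sum x)
    then show "inner \<psi> (P x' d (Q y b \<psi>))
        = (\<Sum>c\<in>A. if g c d = b then inner (P x c \<psi>) (P x' d \<psi>) else 0)"
      by (simp add: P_P_Q b d cong: sum.cong)
  qed (simp add: g)
  then show ?thesis by blast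
qed

text \<open>By \<open>norm_P_P\<close> both orders of the projections map \<open>\<psi>\<close> to vectors of the same length, and
  \<open>P x a (P x' d \<psi>)\<close> has the fixed vector \<open>u\<close> as its component along \<open>u\<close>; so the two vectors are equal.\<close>

lemma P_P_swap:
  assumes x: "x \<in> X" "x' \<in> X" and a: "a \<in> A" and d: "d \<in> A"
    and u: "P x' d (P x a \<psi>) = u" "P x a u = u" "P x' d u = u" "inner \<psi> u = inner u u"
  shows "P x a (P x' d \<psi>) = u"
proof -
  have "(norm (P x a (P x' d \<psi>)))\<^sup>2 = (norm u)\<^sup>2"
    using norm_P_P[OF x a d] norm_P_P[OF x(2,1) d a] u by (simp add: inner_commute)
  moreover have "inner (P x a (P x' d \<psi>)) u = inner u u"
    by (simp add: P_sym x a d u)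
  ultimately have "(norm (P x a (P x' d \<psi>) - u))\<^sup>2 = 0"
    unfolding power2_norm_eq_inner by (simp add: inner_diff_left inner_diff_right inner_commute)
  then show ?thesis by simp
qed

lemma inner_Q_self: "y \<in> Y \<Longrightarrow> b \<in> B \<Longrightarrow> inner \<psi> (Q y b \<psi>) = inner (Q y b \<psi>) (Q y b \<psi>)"
  by (simp add: Q_sym Q_idem)

text \<open>The pairs of answers that can win together with \<open>b\<close> form a box in \<open>A \<times> A\<close>; the boxes
  of those \<open>b\<close> with \<open>Q y b \<psi> \<noteq> 0\<close> are disjoint and nonempty.  If neither question determines Bob's
  answer, then some box is a single point \<open>(a, d)\<close>, and on one of the two lines through that point
  the other point is a box, too.  If this is the line of all pairs with first component \<open>a\<close>, then
  \<open>P x a \<psi>\<close> is the sum of the vectors \<open>Q y b \<psi>\<close> of these two boxes, of which \<open>P x' d\<close> keeps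
  only that of \<open>(a, d)\<close>, and \<open>P_P_swap\<close> applies.\<close>

lemma commute_if_undetermined:
  assumes X: "X = {x, x'}" and y: "y \<in> Y"
    and a: "a \<in> A" "b \<in> B" "b' \<in> B" "b \<noteq> b'" "P x a (Q y b \<psi>) \<noteq> 0" "P x a (Q y b' \<psi>) \<noteq> 0"
    and d: "d \<in> A" "e \<in> B" "e' \<in> B" "e \<noteq> e'" "P x' d (Q y e \<psi>) \<noteq> 0" "P x' d (Q y e' \<psi>) \<noteq> 0"
  shows "P x a (P x' d \<psi>) = P x' d (P x a \<psi>)"
proof -
  have x: "x \<in> X" "x' \<in> X" using X by auto
  obtain a' where a': "a' \<in> A" "a' \<noteq> a" "A = {a, a'}" using other_answer[OF a(1)] .
  obtain d' where d': "d' \<in> A" "d' \<noteq> d" "A = {d, d'}" using other_answer[OF d(1)] .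
  define M where "M c b \<longleftrightarrow> \<Lambda> x y c b \<noteq> 0" for c b
  define N where "N c b \<longleftrightarrow> \<Lambda> x' y c b \<noteq> 0" for c b
  define S where "S = {b \<in> B. Q y b \<psi> \<noteq> 0}"
  have PM: "P x c (Q y b \<psi>) = 0" if "c \<in> A" "b \<in> B" "\<not> M c b" for c b
    using that x y by (auto simp: M_def intro: strategy_perfect)
  have PN: "P x' c (Q y b \<psi>) = 0" if "c \<in> A" "b \<in> B" "\<not> N c b" for c b
    using that x y by (auto simp: N_def intro: strategy_perfect)
  have split: "P x a u + P x a' u = u" for u
    using P_sum[OF x(1), of u] a' by simp
  have split': "P x' d u + P x' d' u = u" for u
    using P_sum[OF x(2), of u] d' by simp
  have boxM: "M a b \<or> M a' b" if "b \<in> S" for b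
    using that split[of "Q y b \<psi>"] PM[OF a(1), of b] PM[OF a'(1), of b] by (force simp: S_def)
  have boxN: "N d b \<or> N d' b" if "b \<in> S" for b
    using that split'[of "Q y b \<psi>"] PN[OF d(1), of b] PN[OF d'(1), of b] by (force simp: S_def)
  have sep: "(\<not> (M a b \<and> M a b') \<and> \<not> (M a' b \<and> M a' b')) \<or>
      (\<not> (N d b \<and> N d b') \<and> \<not> (N d' b \<and> N d' b'))"
    if bb: "b \<in> B" "b' \<in> B" "b \<noteq> b'" for b b'
  proof -
    obtain z where "z \<in> X" and z: "\<And>a. a \<in> A \<Longrightarrow> \<Lambda> z y a b = 0 \<or> \<Lambda> z y a b' = 0"
      using separated_answers_Bob[OF y bb] by metis
    then have "z = x \<or> z = x'" using X by blast
    then show ?thesis using z[OF a(1)] z[OF a'(1)] z[OF d(1)] z[OF d'(1)] by (auto simp: M_def N_def)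
  qed
  have S: "S \<subseteq> B" by (auto simp: S_def)
  have bS: "b \<in> S" "b' \<in> S" "M a b" "M a b'"
    using a PM[OF a(1)] by (auto simp: S_def P_simps x)
  have eS: "e \<in> S" "e' \<in> S" "N d e" "N d e'"
    using d PN[OF d(1)] by (auto simp: S_def P_simps x)
  have "\<exists>b\<in>S. \<exists>b'\<in>S. b \<noteq> b' \<and> M a b \<and> M a b' \<and> N d b \<and> N d' b' \<and> \<not> N d' b \<and> \<not> N d b'"
  proof (cases "N d b")
    case True
    moreover from this have "\<not> N d b'" using sep[OF a(2-4)] bS(3,4) by simp
    moreover from this have "N d' b'" using boxN[OF bS(2)] by simp
    moreover from this have "\<not> N d' b" using sep[OF a(2-4)] bS(3,4) by simp
    ultimately show ?thesis using bS a(4) by (intro bexI[of _ b] bexI[of _ b']) simp_all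
  next
    case False
    moreover from this have "N d' b" using boxN[OF bS(1)] by simp
    moreover from this have "\<not> N d' b'" using sep[OF a(2-4)] bS(3,4) by simp
    moreover from this have "N d b'" using boxN[OF bS(2)] by simp
    ultimately show ?thesis using bS a(4) by (intro bexI[of _ b'] bexI[of _ b]) auto
  qed
  then obtain b b' where b: "b \<in> S" "b' \<in> S" "b \<noteq> b'" "M a b" "M a b'"
    "N d b" "N d' b'" "\<not> N d' b" "\<not> N d b'" by (elim bexE conjE) (rule that; assumption)
  have "\<exists>e\<in>S. \<exists>e'\<in>S. e \<noteq> e' \<and> N d e \<and> N d e' \<and> M a e \<and> M a' e' \<and> \<not> M a' e \<and> \<not> M a e'"
  proof (cases "M a e")
    case True
    moreover from this have "\<not> M a e'" using sep[OF d(2-4)] eS(3,4) by simp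
    moreover from this have "M a' e'" using boxM[OF eS(2)] by simp
    moreover from this have "\<not> M a' e" using sep[OF d(2-4)] eS(3,4) by simp
    ultimately show ?thesis using eS d(4) by (intro bexI[of _ e] bexI[of _ e']) simp_all
  next
    case False
    moreover from this have "M a' e" using boxM[OF eS(1)] by simp
    moreover from this have "\<not> M a' e'" using sep[OF d(2-4)] eS(3,4) by simp
    moreover from this have "M a e'" using boxM[OF eS(2)] by simp
    ultimately show ?thesis using eS d(4) by (intro bexI[of _ e'] bexI[of _ e]) auto
  qed
  then obtain e e' where e: "e \<in> S" "e' \<in> S" "e \<noteq> e'" "N d e" "N d e'"
    "M a e" "M a' e'" "\<not> M a' e" "\<not> M a e'" by (elim bexE conjE) (rule that; assumption)
  have "e = b" using sep[of e b] b e S by blast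
  note e = e[unfolded this]
  have inB: "b \<in> B" "b' \<in> B" "e' \<in> B" using b e S by auto
  have "b' \<noteq> e'" using b e by blast
  let ?u = "\<lambda>b. Q y b \<psi>"
  have u: "P x a (?u b) = ?u b" "P x' d (?u b) = ?u b"
    using split[of "?u b"] split'[of "?u b"] PM[OF a'(1) inB(1) e(8)] PN[OF d'(1) inB(1) b(8)] by simp_all
  \<comment> \<open>Each of the two lines through the point box of \<open>b\<close> meets one further box.\<close>
  have "P x a (?u c) = 0" if c: "c \<in> B" "c \<noteq> b" "c \<noteq> b'" for c
  proof (cases "c \<in> S")
    case True
    then have "\<not> M a c"
      using boxN[OF True] sep[of c b] sep[of c b'] b c inB by blast
    then show ?thesis using PM a c by blast
  qed (use c in \<open>simp add: S_def P_simps x a\<close>)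
  then have "(\<Sum>c\<in>B. P x a (?u c)) = (\<Sum>c\<in>{b, b'}. P x a (?u c))"
    using inB by (intro sum.mono_neutral_right finite_B) auto
  moreover have "P x a \<psi> = (\<Sum>c\<in>B. P x a (?u c))"
    using P_simps(4)[OF x(1) a(1), of ?u B] Q_sum[OF y] by simp
  ultimately have row: "P x a \<psi> = ?u b + P x a (?u b')"
    using b u by simp
  have "P x' d (?u c) = 0" if c: "c \<in> B" "c \<noteq> b" "c \<noteq> e'" for c
  proof (cases "c \<in> S")
    case True
    then have "\<not> N d c"
      using boxM[OF True] sep[of c b] sep[of c e'] b e c inB by blast
    then show ?thesis using PN d c by blast
  qed (use c in \<open>simp add: S_def P_simps x d\<close>)
  then have "(\<Sum>c\<in>B. P x' d (?u c)) = (\<Sum>c\<in>{b, e'}. P x' d (?u c))"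
    using inB by (intro sum.mono_neutral_right finite_B) auto
  moreover have "P x' d \<psi> = (\<Sum>c\<in>B. P x' d (?u c))"
    using P_simps(4)[OF x(2) d(1), of ?u B] Q_sum[OF y] by simp
  ultimately have column: "P x' d \<psi> = ?u b + P x' d (?u e')"
    using e u by simp
  \<comment> \<open>The further boxes are disjoint, so one of them is a point as well.\<close>
  have "\<not> M a' b' \<or> \<not> N d' e'"
    using sep[of b' e'] inB b e \<open>b' \<noteq> e'\<close> by blast
  then show ?thesis
  proof
    assume "\<not> M a' b'"
    then have "P x a (?u b') = ?u b'"
      using split[of "?u b'"] PM[OF a'(1) inB(2)] by simp
    then have *: "P x' d (P x a \<psi>) = ?u b"
      using PN[OF d(1) inB(2) b(9)] u by (simp add: row P_simps x d)
    then show ?thesis using P_P_swap[OF x a(1) d(1) *] u inner_Q_self[OF y inB(1)] by simp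
  next
    assume "\<not> N d' e'"
    then have "P x' d (?u e') = ?u e'"
      using split'[of "?u e'"] PN[OF d'(1) inB(3)] by simp
    then have *: "P x a (P x' d \<psi>) = ?u b"
      using PM[OF a(1) inB(3) e(9)] u by (simp add: column P_simps x a)
    then show ?thesis using P_P_swap[OF x(2,1) d(1) a(1) *] u inner_Q_self[OF y inB(1)] by simp
  qed
qed

text \<open>The projections for the two answers to a question are complementary.\<close>

lemma commute_all:
  assumes x: "x \<in> X" "x' \<in> X" and ad: "a \<in> A" "d \<in> A"
    and comm: "P x a (P x' d \<psi>) = P x' d (P x a \<psi>)" and "c \<in> A" "f \<in> A"
  shows "P x c (P x' f \<psi>) = P x' f (P x c \<psi>)"
proof -
  obtain a' where a': "a' \<in> A" "a' \<noteq> a" "A = {a, a'}" using other_answer[OF ad(1)] .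
  obtain d' where d': "d' \<in> A" "d' \<noteq> d" "A = {d, d'}" using other_answer[OF ad(2)] .
  have Pa': "P x a' u = u - P x a u" for u
    using P_sum[OF x(1), of u] a' by (simp add: eq_diff_eq add.commute)
  have Pd': "P x' d' u = u - P x' d u" for u
    using P_sum[OF x(2), of u] d' by (simp add: eq_diff_eq add.commute)
  have "c = a \<or> c = a'" "f = d \<or> f = d'" using assms(6,7) a' d' by auto
  then show ?thesis by (auto simp: Pa' Pd' P_simps x ad comm)
qed

lemma classical_response_exists:
  assumes X: "X = {x, x'}" and y: "y \<in> Y"
  shows "\<exists>g. classical_response x x' y g"
proof (cases "\<exists>a b b'. a \<in> A \<and> b \<in> B \<and> b' \<in> B \<and> b \<noteq> b' \<and> P x a (Q y b \<psi>) \<noteq> 0 \<and> P x a (Q y b' \<psi>) \<noteq> 0")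
  case False
  then show ?thesis using X y by (intro classical_response_if_determined) auto
next
  case 1: True
  show ?thesis
  proof (cases "\<exists>a b b'. a \<in> A \<and> b \<in> B \<and> b' \<in> B \<and> b \<noteq> b' \<and>
      P x' a (Q y b \<psi>) \<noteq> 0 \<and> P x' a (Q y b' \<psi>) \<noteq> 0")
    case False
    then have "\<exists>g. classical_response x' x y g"
      using X y by (intro classical_response_if_determined) auto
    then show ?thesis using classical_response_swap by blast
  next
    case True
    with 1 obtain a d where "a \<in> A" "d \<in> A" "P x a (P x' d \<psi>) = P x' d (P x a \<psi>)"
      using commute_if_undetermined[OF X y] by metis
    then show ?thesis using commute_all[of x x' a d] X y
      by (intro classical_response_if_commute) auto
  qed
qed

end

section \<open>Diagonal operators and their amenable traces\<close>

definition diagonal_with :: "('i \<Rightarrow> complex) \<Rightarrow> 'i ell2 operator \<Rightarrow> bool" where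
  "diagonal_with g T \<longleftrightarrow> (\<forall>x i. coord (blinfun_apply T x) i = g i * coord x i)"

definition diagonal :: "'i ell2 operator set" where
  "diagonal = {T. \<exists>g. diagonal_with g T}"

lemma diagonal_withD: "diagonal_with g T \<Longrightarrow> coord (blinfun_apply T x) i = g i * coord x i"
  by (simp add: diagonal_with_def)

lemma diagonal_with_unique: "diagonal_with g S \<Longrightarrow> diagonal_with g T \<Longrightarrow> S = T"
  by (intro blinfun_eqI ell2_eqI) (simp add: diagonal_withD)

lemma diagonal_with_in_bop: "diagonal_with g T \<Longrightarrow> T \<in> bop"
  unfolding bop_def mem_Collect_eq by (intro allI ell2_eqI) (simp add: diagonal_withD)

lemma diagonal_with_in_diagonal: "diagonal_with g T \<Longrightarrow> T \<in> diagonal"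
  by (auto simp: diagonal_def)

lemma diagonal_with_exists:
  assumes g: "\<And>i. cmod (g i) \<le> 1"
  obtains T where "diagonal_with g T"
proof -
  have le: "(cmod (g i * coord x i))\<^sup>2 \<le> (cmod (coord x i))\<^sup>2" for x :: "'a ell2" and i
    using mult_right_mono[OF g[of i], of "cmod (coord x i)"] by (intro power_mono) (simp_all add: norm_mult)
  have summable: "(\<lambda>i. (cmod (g i * coord x i))\<^sup>2) summable_on UNIV" for x :: "'a ell2"
    by (rule summable_on_comparison_test[OF coord_sq_summable[of x]]) (use le in auto)
  define h where "h x = Abs_ell2 (\<lambda>i. g i * coord x i)" for x
  have ch: "coord (h x) i = g i * coord x i" for x i
    by (simp add: h_def Abs_ell2_inverse summable)
  have "bounded_linear h"
  proof (rule bounded_linear_intro)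
    show "h (x + y) = h x + h y" for x y by (rule ell2_eqI) (simp add: ch distrib_left)
    show "h (r *\<^sub>R x) = r *\<^sub>R h x" for r x by (rule ell2_eqI) (simp add: ch)
    show "norm (h x) \<le> norm x * 1" for x
    proof (rule power2_le_imp_le)
      show "(norm (h x))\<^sup>2 \<le> (norm x * 1)\<^sup>2"
        unfolding ell2_sq_norm ch mult_1_right
        by (rule infsum_mono[OF summable coord_sq_summable]) (rule le)
    qed simp
  qed
  then have "diagonal_with g (Blinfun h)"
    by (simp add: diagonal_with_def bounded_linear_Blinfun_apply ch)
  then show thesis by (rule that)
qed

lemma diagonal_with_zero: "diagonal_with (\<lambda>_. 0) 0"
  by (simp add: diagonal_with_def)
lemma diagonal_with_add:
  "diagonal_with g S \<Longrightarrow> diagonal_with h T \<Longrightarrow> diagonal_with (\<lambda>i. g i + h i) (S + T)"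
  by (simp add: diagonal_with_def blinfun.add_left distrib_right)
lemma diagonal_with_compose:
  "diagonal_with g S \<Longrightarrow> diagonal_with h T \<Longrightarrow> diagonal_with (\<lambda>i. g i * h i) (S o\<^sub>L T)"
  by (simp add: diagonal_with_def)
lemma diagonal_with_scale: "diagonal_with g T \<Longrightarrow> diagonal_with (\<lambda>i. c * g i) (op_scale c T)"
  by (simp add: diagonal_with_def)
lemma diagonal_with_ket: "diagonal_with g T \<Longrightarrow> blinfun_apply T (ket i) = g i *\<^sub>C ket i"
  by (rule ell2_eqI) (simp add: diagonal_withD coord_ket)
lemma diagonal_with_adj: "diagonal_with g T \<Longrightarrow> diagonal_with (\<lambda>i. cnj (g i)) (adj T)"
  unfolding diagonal_with_def[of _ "adj T"]
  by (simp add: coord_adj diagonal_with_in_bop diagonal_with_ket cinner_scaleC_left cinner_ket)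

lemma diagonal_commute: "S \<in> diagonal \<Longrightarrow> T \<in> diagonal \<Longrightarrow> S o\<^sub>L T = T o\<^sub>L S"
  by (intro blinfun_eqI ell2_eqI) (auto simp: diagonal_def diagonal_withD)

lemma subalgebra_diagonal: "subalgebra (diagonal :: 'i ell2 operator set)"
  unfolding subalgebra_def
proof (intro conjI ballI allI subsetI)
  show "0 \<in> diagonal" by (rule diagonal_with_in_diagonal[OF diagonal_with_zero])
  show "T \<in> bop" if "T \<in> diagonal" for T :: "'i ell2 operator"
    using that by (auto simp: diagonal_def intro: diagonal_with_in_bop)
  show "op_scale c T \<in> diagonal" if "T \<in> diagonal" for c and T :: "'i ell2 operator"
    using that by (auto simp: diagonal_def dest: diagonal_with_scale)
  fix S T :: "'i ell2 operator" assume "S \<in> diagonal" "T \<in> diagonal"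
  then obtain g h where "diagonal_with g S" "diagonal_with h T" by (auto simp: diagonal_def)
  then show "S + T \<in> diagonal" "S o\<^sub>L T \<in> diagonal"
    by (auto intro: diagonal_with_in_diagonal diagonal_with_add diagonal_with_compose)
qed

text \<open>The diagonal operators are their own commutant: an operator that commutes with the projections
  onto the lines of the basis vectors has each basis vector as an eigenvector.\<close>

lemma commutant_diagonal: "commutant diagonal = diagonal"
proof (intro equalityI subsetI)
  fix T :: "'i ell2 operator" assume "T \<in> commutant diagonal"
  then have T: "T \<in> bop" and comm: "\<And>S. S \<in> diagonal \<Longrightarrow> S o\<^sub>L T = T o\<^sub>L S"
    by (auto simp: commutant_def)
  have "coord (blinfun_apply T x) i = coord (blinfun_apply T (ket i)) i * coord x i" for x i
  proof -
    obtain D :: "'i ell2 operator" where D: "diagonal_with (\<lambda>j. if j = i then 1 else 0) D"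
      by (rule diagonal_with_exists[of "\<lambda>j. if j = i then 1 else 0"]) simp_all
    have "blinfun_apply D x = coord x i *\<^sub>C ket i"
      by (rule ell2_eqI) (simp add: diagonal_withD[OF D] coord_ket)
    then have "blinfun_apply (T o\<^sub>L D) x = coord x i *\<^sub>C blinfun_apply T (ket i)"
      by (simp add: bopD[OF T])
    then have "blinfun_apply D (blinfun_apply T x) = coord x i *\<^sub>C blinfun_apply T (ket i)"
      using comm[OF diagonal_with_in_diagonal[OF D]] by (metis blinfun_apply_blinfun_compose)
    then have "coord (blinfun_apply D (blinfun_apply T x)) i = coord x i * coord (blinfun_apply T (ket i)) i"
      by simp
    then show ?thesis by (simp add: diagonal_withD[OF D] mult.commute)
  qed
  then have "diagonal_with (\<lambda>i. coord (blinfun_apply T (ket i)) i) T"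
    unfolding diagonal_with_def by blast
  then show "T \<in> diagonal" by (rule diagonal_with_in_diagonal)
next
  fix T :: "'i ell2 operator" assume "T \<in> diagonal"
  then show "T \<in> commutant diagonal"
    using diagonal_commute subalgebraD(1)[OF subalgebra_diagonal] by (auto simp: commutant_def)
qed

lemma von_neumann_algebra_diagonal: "von_neumann_algebra diagonal"
  unfolding von_neumann_algebra_def commutant_diagonal
  using diagonal_with_adj by (auto simp: subalgebra_diagonal) (auto simp: diagonal_def)

definition mixture :: "nat \<Rightarrow> (nat \<Rightarrow> real) \<Rightarrow> nat ell2 operator \<Rightarrow> complex" where
  "mixture N w T = (\<Sum>k<N. complex_of_real (w k) * coord (blinfun_apply T (ket k)) k)"

lemma mixture_state:
  assumes w: "\<And>k. k < N \<Longrightarrow> 0 \<le> w k" "(\<Sum>k<N. w k) = 1"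
  shows "state bop (mixture N w)"
  unfolding state_def
proof (intro conjI ballI allI)
  show "mixture N w (S + T) = mixture N w S + mixture N w T" for S T
    by (simp add: mixture_def blinfun.add_left distrib_left sum.distrib)
  show "mixture N w (op_scale c T) = c * mixture N w T" for c T
    by (simp add: mixture_def sum_distrib_left mult_ac)
  show "mixture N w id_blinfun = 1"
    using w(2) by (simp add: mixture_def coord_ket flip: of_real_sum)
  fix T :: "nat ell2 operator" assume T: "T \<in> bop"
  have "mixture N w (adj T o\<^sub>L T) = complex_of_real (\<Sum>k<N. w k * (norm (blinfun_apply T (ket k)))\<^sup>2)"
    by (simp add: mixture_def coord_adj T cinner_self)
  then show "mixture N w (adj T o\<^sub>L T) \<in> \<real>\<^sub>\<ge>\<^sub>0"
    using w(1) by (simp only: nonneg_Reals_of_real_iff) (auto intro!: sum_nonneg)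
qed

text \<open>A diagonal unitary multiplies each basis vector by a phase, which cancels in the corresponding
  diagonal entry of \<open>u T u\<^sup>*\<close>.\<close>

lemma mixture_amenable:
  assumes w: "\<And>k. k < N \<Longrightarrow> 0 \<le> w k" "(\<Sum>k<N. w k) = 1"
  shows "amenable_tracial_state diagonal (mixture N w)"
proof -
  have state: "state bop (mixture N w)" by (rule mixture_state[OF w])
  have inv: "mixture N w (u o\<^sub>L T o\<^sub>L adj u) = mixture N w T"
    if T: "T \<in> bop" and u: "u \<in> diagonal" "unitary u" for T u
  proof -
    obtain g where g: "diagonal_with g u" using u by (auto simp: diagonal_def)
    have phase: "g k * cnj (g k) = 1" for k
    proof -
      have "coord (blinfun_apply (u o\<^sub>L adj u) (ket k)) k = 1"
        using u by (simp add: unitary_def coord_ket)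
      then show ?thesis
        by (simp add: diagonal_withD[OF g] diagonal_withD[OF diagonal_with_adj[OF g]] coord_ket)
    qed
    have "coord (blinfun_apply (u o\<^sub>L T o\<^sub>L adj u) (ket k)) k
        = (g k * cnj (g k)) * coord (blinfun_apply T (ket k)) k" for k
      by (simp add: diagonal_with_ket[OF diagonal_with_adj[OF g]] bopD[OF T] diagonal_withD[OF g])
    then show ?thesis by (simp add: mixture_def phase)
  qed
  have "state diagonal (mixture N w)"
    using state subalgebraD(1)[OF subalgebra_diagonal] unfolding state_def by meson
  then have "tracial_state diagonal (mixture N w)"
    by (simp add: tracial_state_def diagonal_commute)
  then show ?thesis using state inv by (auto simp: amenable_tracial_state_def)
qed

section \<open>Product homomorphisms on algebraic tensor products\<close>

text \<open>\<open>\<theta>\<close> and \<open>\<theta>'\<close> have commuting values, so \<open>S \<otimes>\<^sub>o T \<mapsto> \<theta> S o\<^sub>L \<theta>' T\<close> should extend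
  to the span of the elementary tensors.  The relation collects the values that linearity forces
  upon the extension.\<close>

inductive product_graph ::
  "'i ell2 operator set \<Rightarrow> 'j ell2 operator set \<Rightarrow> ('i ell2 operator \<Rightarrow> 'k ell2 operator) \<Rightarrow>
    ('j ell2 operator \<Rightarrow> 'k ell2 operator) \<Rightarrow> ('i \<times> 'j) ell2 operator \<Rightarrow> 'k ell2 operator \<Rightarrow> bool"
  for M N \<theta> \<theta>' where
  zero: "product_graph M N \<theta> \<theta>' 0 0"
| step: "S \<in> M \<Longrightarrow> T \<in> N \<Longrightarrow> product_graph M N \<theta> \<theta>' R V \<Longrightarrow>
    product_graph M N \<theta> \<theta>' (S \<otimes>\<^sub>o T + R) ((\<theta> S o\<^sub>L \<theta>' T) + V)"

locale diagonal_homs =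
  fixes M :: "'i ell2 operator set" and N :: "'j ell2 operator set"
    and \<theta> :: "'i ell2 operator \<Rightarrow> 'k ell2 operator"
    and \<theta>' :: "'j ell2 operator \<Rightarrow> 'k ell2 operator"
  assumes subM: "subalgebra M" and subN: "subalgebra N"
    and adjM: "\<And>T. T \<in> M \<Longrightarrow> adj T \<in> M" and adjN: "\<And>T. T \<in> N \<Longrightarrow> adj T \<in> N"
    and idM: "id_blinfun \<in> M" and idN: "id_blinfun \<in> N"
    and hom: "star_hom M diagonal \<theta>" and hom': "star_hom N diagonal \<theta>'"
begin

abbreviation graph :: "('i \<times> 'j) ell2 operator \<Rightarrow> 'k ell2 operator \<Rightarrow> bool" where
  "graph \<equiv> product_graph M N \<theta> \<theta>'"

lemma hom_simps:
  "S \<in> M \<Longrightarrow> \<theta> S \<in> diagonal" "\<theta> id_blinfun = id_blinfun"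
  "S \<in> M \<Longrightarrow> T \<in> M \<Longrightarrow> \<theta> (S + T) = \<theta> S + \<theta> T"
  "S \<in> M \<Longrightarrow> T \<in> M \<Longrightarrow> \<theta> (S o\<^sub>L T) = \<theta> S o\<^sub>L \<theta> T"
  "S \<in> M \<Longrightarrow> \<theta> (op_scale c S) = op_scale c (\<theta> S)" "S \<in> M \<Longrightarrow> \<theta> (adj S) = adj (\<theta> S)"
  using hom by (auto simp: star_hom_def)

lemma hom'_simps:
  "S \<in> N \<Longrightarrow> \<theta>' S \<in> diagonal" "\<theta>' id_blinfun = id_blinfun"
  "S \<in> N \<Longrightarrow> T \<in> N \<Longrightarrow> \<theta>' (S + T) = \<theta>' S + \<theta>' T"
  "S \<in> N \<Longrightarrow> T \<in> N \<Longrightarrow> \<theta>' (S o\<^sub>L T) = \<theta>' S o\<^sub>L \<theta>' T"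
  "S \<in> N \<Longrightarrow> \<theta>' (op_scale c S) = op_scale c (\<theta>' S)" "S \<in> N \<Longrightarrow> \<theta>' (adj S) = adj (\<theta>' S)"
  using hom' by (auto simp: star_hom_def)

lemmas inM = subalgebraD[OF subM] and inN = subalgebraD[OF subN]
  and inD = subalgebraD[OF subalgebra_diagonal]

lemma graph_bop: "graph R V \<Longrightarrow> R \<in> bop" and graph_diagonal: "graph R V \<Longrightarrow> V \<in> diagonal"
  by (induction rule: product_graph.induct)
    (auto simp: bop_zero bop_add tensor_op_in_bop inM inN inD hom_simps hom'_simps)

lemma graph_elementary: "S \<in> M \<Longrightarrow> T \<in> N \<Longrightarrow> graph (S \<otimes>\<^sub>o T) (\<theta> S o\<^sub>L \<theta>' T)"
  using product_graph.step[OF _ _ product_graph.zero] by simp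

lemma graph_add: "graph R V \<Longrightarrow> graph R' V' \<Longrightarrow> graph (R + R') (V + V')"
  by (induction rule: product_graph.induct) (auto simp: add.assoc intro: product_graph.step)

lemma graph_compose_elementary:
  assumes "graph R V" and S: "S \<in> M" and T: "T \<in> N"
  shows "graph ((S \<otimes>\<^sub>o T) o\<^sub>L R) ((\<theta> S o\<^sub>L \<theta>' T) o\<^sub>L V)"
  using assms(1)
proof (induction rule: product_graph.induct)
  case zero
  have "(S \<otimes>\<^sub>o T) o\<^sub>L 0 = 0" "(\<theta> S o\<^sub>L \<theta>' T) o\<^sub>L 0 = 0"
    by (auto intro!: blinfun_eqI)
  then show ?case by (simp add: product_graph.zero)
next
  case (step S' T' R V)
  have "(\<theta> S o\<^sub>L \<theta>' T) o\<^sub>L (\<theta> S' o\<^sub>L \<theta>' T') = \<theta> S o\<^sub>L ((\<theta>' T o\<^sub>L \<theta> S') o\<^sub>L \<theta>' T')"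
    by (simp add: compose_assoc)
  also have "\<theta>' T o\<^sub>L \<theta> S' = \<theta> S' o\<^sub>L \<theta>' T"
    by (rule diagonal_commute) (simp_all add: hom_simps hom'_simps T step)
  finally have "(\<theta> S o\<^sub>L \<theta>' T) o\<^sub>L (\<theta> S' o\<^sub>L \<theta>' T') = \<theta> (S o\<^sub>L S') o\<^sub>L \<theta>' (T o\<^sub>L T')"
    by (simp add: hom_simps hom'_simps S T step compose_assoc)
  moreover have "(S \<otimes>\<^sub>o T) o\<^sub>L (S' \<otimes>\<^sub>o T') = (S o\<^sub>L S') \<otimes>\<^sub>o (T o\<^sub>L T')"
    by (simp add: tensor_op_compose inM inN S T step)
  ultimately show ?case
    using product_graph.step[OF inM(4)[OF S step.hyps(1)] inN(4)[OF T step.hyps(2)] step.IH]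
    by (simp add: compose_add_right)
qed

lemma graph_compose: "graph R V \<Longrightarrow> graph R' V' \<Longrightarrow> graph (R o\<^sub>L R') (V o\<^sub>L V')"
proof (induction rule: product_graph.induct)
  case zero
  have "0 o\<^sub>L R' = 0" "0 o\<^sub>L V' = 0"
    by (auto intro!: blinfun_eqI)
  then show ?case by (simp add: product_graph.zero)
next
  case (step S T R V)
  then show ?case by (simp add: compose_add_left graph_add graph_compose_elementary)
qed

lemma graph_scale: "graph R V \<Longrightarrow> graph (op_scale c R) (op_scale c V)"
proof (induction rule: product_graph.induct)
  case zero
  have "op_scale c 0 = (0 :: ('i \<times> 'j) ell2 operator)" "op_scale c 0 = (0 :: 'k ell2 operator)"
    by (auto intro!: blinfun_eqI)
  then show ?case by (simp add: product_graph.zero)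
next
  case (step S T R V)
  have "op_scale c (S \<otimes>\<^sub>o T + R) = op_scale c S \<otimes>\<^sub>o T + op_scale c R"
    unfolding tensor_op_scale[OF inM(1)[OF step.hyps(1)] inN(1)[OF step.hyps(2)]]
    by (rule blinfun_eqI) (simp add: blinfun.add_left scaleC_add_right)
  moreover have "op_scale c ((\<theta> S o\<^sub>L \<theta>' T) + V) = (\<theta> (op_scale c S) o\<^sub>L \<theta>' T) + op_scale c V"
    by (rule blinfun_eqI) (simp add: blinfun.add_left scaleC_add_right hom_simps step)
  ultimately show ?case
    using product_graph.step[OF inM(5)[OF step.hyps(1)] step.hyps(2) step.IH] by simp
qed

lemma graph_adj: "graph R V \<Longrightarrow> graph (adj R) (adj V)"
proof (induction rule: product_graph.induct)
  case zero
  then show ?case by (simp add: adj_zero product_graph.zero)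
next
  case (step S T R V)
  have ST: "S \<in> bop" "T \<in> bop" "\<theta> S \<in> bop" "\<theta>' T \<in> bop" "adj (\<theta> S) \<in> diagonal" "adj (\<theta>' T) \<in> diagonal"
    using step by (simp_all add: inM inN inD hom_simps hom'_simps adjM adjN
        flip: hom_simps(6) hom'_simps(6))
  have "adj (S \<otimes>\<^sub>o T + R) = adj S \<otimes>\<^sub>o adj T + adj R"
    by (simp only: adj_add[OF tensor_op_in_bop[OF ST(1,2)] graph_bop[OF step.hyps(3)]]
        adj_tensor_op[OF ST(1,2)])
  moreover have "adj ((\<theta> S o\<^sub>L \<theta>' T) + V) = (\<theta> (adj S) o\<^sub>L \<theta>' (adj T)) + adj V"
    using graph_diagonal[OF step.hyps(3)]
    by (simp add: adj_add adj_compose bop_compose inD ST hom_simps hom'_simps step diagonal_commute)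
  ultimately show ?case
    using product_graph.step[OF adjM[OF step.hyps(1)] adjN[OF step.hyps(2)] step.IH] by simp
qed

text \<open>The diagonal entries of \<open>V\<close> are determined by \<open>R\<close>.  With the characters \<open>\<chi>\<close> and
  \<open>\<chi>'\<close> that give the \<open>k\<close>-th entries of \<open>\<theta>\<close> and \<open>\<theta>'\<close>, and \<open>R = (\<Sum>i. S i \<otimes> T i)\<close>, the slices
  \<open>W = (\<Sum>i. cinner v (S i v') T i)\<close> are compressions of \<open>R\<close>; applying \<open>\<chi>'\<close> to them gives the
  matrix entries of \<open>Z = (\<Sum>i. \<chi>' (T i) S i)\<close>; and \<open>\<chi> Z\<close> is the entry sought.\<close>

lemma graph_slices:
  assumes "graph R V"
  shows "\<exists>Z\<in>M. coord (blinfun_apply (\<theta> Z) (ket k)) k = coord (blinfun_apply V (ket k)) k \<and>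
    (\<forall>v v'. \<exists>W\<in>N. coord (blinfun_apply (\<theta>' W) (ket k)) k = cinner v (blinfun_apply Z v') \<and>
      (\<forall>w w'. cinner w (blinfun_apply W w') = cinner (v \<otimes>\<^sub>v w) (blinfun_apply R (v' \<otimes>\<^sub>v w'))))"
  using assms
proof (induction rule: product_graph.induct)
  case zero
  have 0: "\<theta> 0 = 0" "\<theta>' 0 = 0"
    using hom_simps(3)[of 0 0] hom'_simps(3)[of 0 0] by (simp_all add: inM inN)
  show ?case
    by (intro bexI[of _ 0] conjI allI) (simp_all add: inM inN 0)
next
  case (step S T R V)
  then obtain Z where Z: "Z \<in> M" "coord (blinfun_apply (\<theta> Z) (ket k)) k = coord (blinfun_apply V (ket k)) k"
    "\<And>v v'. \<exists>W\<in>N. coord (blinfun_apply (\<theta>' W) (ket k)) k = cinner v (blinfun_apply Z v') \<and>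
      (\<forall>w w'. cinner w (blinfun_apply W w') = cinner (v \<otimes>\<^sub>v w) (blinfun_apply R (v' \<otimes>\<^sub>v w')))"
    by blast
  obtain g where g: "diagonal_with g (\<theta> S)"
    using hom_simps(1)[OF step.hyps(1)] by (auto simp: diagonal_def)
  obtain g' where g': "diagonal_with g' (\<theta>' T)"
    using hom'_simps(1)[OF step.hyps(2)] by (auto simp: diagonal_def)
  show ?case
  proof (intro bexI[of _ "op_scale (g' k) S + Z"] conjI allI)
    show "op_scale (g' k) S + Z \<in> M" by (simp add: inM step Z)
    show "coord (blinfun_apply (\<theta> (op_scale (g' k) S + Z)) (ket k)) k
        = coord (blinfun_apply ((\<theta> S o\<^sub>L \<theta>' T) + V) (ket k)) k"
      by (simp add: hom_simps inM step Z blinfun.add_left diagonal_withD[OF g] diagonal_withD[OF g'] coord_ket)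
    fix v v'
    obtain W where W: "W \<in> N" "coord (blinfun_apply (\<theta>' W) (ket k)) k = cinner v (blinfun_apply Z v')"
      "\<And>w w'. cinner w (blinfun_apply W w') = cinner (v \<otimes>\<^sub>v w) (blinfun_apply R (v' \<otimes>\<^sub>v w'))"
      using Z(3)[of v v'] by blast
    let ?c = "cinner v (blinfun_apply S v')"
    show "\<exists>W\<in>N. coord (blinfun_apply (\<theta>' W) (ket k)) k = cinner v (blinfun_apply (op_scale (g' k) S + Z) v') \<and>
      (\<forall>w w'. cinner w (blinfun_apply W w') =
        cinner (v \<otimes>\<^sub>v w) (blinfun_apply (S \<otimes>\<^sub>o T + R) (v' \<otimes>\<^sub>v w')))"
    proof (intro bexI[of _ "op_scale ?c T + W"] conjI allI)
      show "op_scale ?c T + W \<in> N" by (simp add: inN step W)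
      show "coord (blinfun_apply (\<theta>' (op_scale ?c T + W)) (ket k)) k
          = cinner v (blinfun_apply (op_scale (g' k) S + Z) v')"
        by (simp add: hom'_simps inN step W blinfun.add_left diagonal_withD[OF g'] coord_ket
            cinner_add_right cinner_scaleC_right)
      show "cinner w (blinfun_apply (op_scale ?c T + W) w')
          = cinner (v \<otimes>\<^sub>v w) (blinfun_apply (S \<otimes>\<^sub>o T + R) (v' \<otimes>\<^sub>v w'))" for w w'
        by (simp add: blinfun.add_left cinner_add_right cinner_scaleC_right W tensor_op_apply inM inN
            step cinner_tensor_vec)
    qed
  qed
qed

lemma graph_unique:
  assumes "graph R V" "graph R V'"
  shows "V = V'"
proof -
  have "coord (blinfun_apply V (ket k)) k = coord (blinfun_apply V' (ket k)) k" for k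
  proof -
    from graph_slices[OF assms(1), of k] obtain Z where Z: "Z \<in> M"
      "coord (blinfun_apply (\<theta> Z) (ket k)) k = coord (blinfun_apply V (ket k)) k"
      "\<And>v v'. \<exists>W\<in>N. coord (blinfun_apply (\<theta>' W) (ket k)) k = cinner v (blinfun_apply Z v') \<and>
        (\<forall>w w'. cinner w (blinfun_apply W w') = cinner (v \<otimes>\<^sub>v w) (blinfun_apply R (v' \<otimes>\<^sub>v w')))"
      by blast
    from graph_slices[OF assms(2), of k] obtain Z' where Z': "Z' \<in> M"
      "coord (blinfun_apply (\<theta> Z') (ket k)) k = coord (blinfun_apply V' (ket k)) k"
      "\<And>v v'. \<exists>W\<in>N. coord (blinfun_apply (\<theta>' W) (ket k)) k = cinner v (blinfun_apply Z' v') \<and>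
        (\<forall>w w'. cinner w (blinfun_apply W w') = cinner (v \<otimes>\<^sub>v w) (blinfun_apply R (v' \<otimes>\<^sub>v w')))"
      by blast
    have "cinner v (blinfun_apply Z v') = cinner v (blinfun_apply Z' v')" for v v'
    proof -
      obtain W where W: "coord (blinfun_apply (\<theta>' W) (ket k)) k = cinner v (blinfun_apply Z v')"
        "\<And>w w'. cinner w (blinfun_apply W w') = cinner (v \<otimes>\<^sub>v w) (blinfun_apply R (v' \<otimes>\<^sub>v w'))"
        using Z(3)[of v v'] by blast
      obtain W' where W': "coord (blinfun_apply (\<theta>' W') (ket k)) k = cinner v (blinfun_apply Z' v')"
        "\<And>w w'. cinner w (blinfun_apply W' w') = cinner (v \<otimes>\<^sub>v w) (blinfun_apply R (v' \<otimes>\<^sub>v w'))"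
        using Z'(3)[of v v'] by blast
      have "W = W'" by (intro blinfun_eqI cinner_ext) (simp add: W W')
      then show ?thesis using W(1) W'(1) by simp
    qed
    then have "Z = Z'" by (intro blinfun_eqI cinner_ext)
    then show ?thesis using Z(2) Z'(2) by simp
  qed
  moreover obtain g g' where gg': "diagonal_with g V" "diagonal_with g' V'"
    using assms[THEN graph_diagonal] by (auto simp: diagonal_def)
  ultimately have "g = g'"
    by (intro ext) (metis diagonal_withD coord_ket mult.right_neutral)
  then show ?thesis using gg' diagonal_with_unique by blast
qed

lemma graph_total: "R \<in> alg_tensor M N \<Longrightarrow> \<exists>V. graph R V"
proof -
  have "\<exists>V. graph (\<Sum>k<n. S k \<otimes>\<^sub>o T k) V" if "\<forall>k<n. S k \<in> M \<and> T k \<in> N" for n :: nat and S T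
    using that
  proof (induction n)
    case 0
    then show ?case by (auto intro: product_graph.zero)
  next
    case (Suc n)
    then obtain V where "graph (\<Sum>k<n. S k \<otimes>\<^sub>o T k) V" by auto
    then have "graph (S n \<otimes>\<^sub>o T n + (\<Sum>k<n. S k \<otimes>\<^sub>o T k)) ((\<theta> (S n) o\<^sub>L \<theta>' (T n)) + V)"
      using Suc.prems by (intro product_graph.step) auto
    then show ?case by (auto simp: add.commute)
  qed
  then show "R \<in> alg_tensor M N \<Longrightarrow> \<exists>V. graph R V" by (auto simp: alg_tensor_def)
qed

lemma product_hom_exists:
  obtains \<rho> where "star_hom (alg_tensor M N) diagonal \<rho>"
    "\<And>S T. S \<in> M \<Longrightarrow> T \<in> N \<Longrightarrow> \<rho> (S \<otimes>\<^sub>o T) = \<theta> S o\<^sub>L \<theta>' T"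
proof
  define \<rho> where "\<rho> R = (THE V. graph R V)" for R
  have \<rho>_eq: "\<rho> R = V" if "graph R V" for R V
    unfolding \<rho>_def using that graph_unique by blast
  have \<rho>: "graph R (\<rho> R)" if "R \<in> alg_tensor M N" for R
    using graph_total[OF that] \<rho>_eq by metis
  show elementary: "\<rho> (S \<otimes>\<^sub>o T) = \<theta> S o\<^sub>L \<theta>' T" if "S \<in> M" "T \<in> N" for S T
    by (rule \<rho>_eq) (rule graph_elementary[OF that])
  show "star_hom (alg_tensor M N) diagonal \<rho>"
    unfolding star_hom_def
  proof (intro conjI ballI allI)
    show "\<rho> ` alg_tensor M N \<subseteq> diagonal"
      using \<rho> graph_diagonal by blast
    show "\<rho> id_blinfun = id_blinfun"
      using elementary[OF idM idN] by (simp add: tensor_op_id hom_simps hom'_simps)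
    fix R R' assume R: "R \<in> alg_tensor M N" and R': "R' \<in> alg_tensor M N"
    show "\<rho> (R + R') = \<rho> R + \<rho> R'"
      by (rule \<rho>_eq) (rule graph_add[OF \<rho>[OF R] \<rho>[OF R']])
    show "\<rho> (R o\<^sub>L R') = \<rho> R o\<^sub>L \<rho> R'"
      by (rule \<rho>_eq) (rule graph_compose[OF \<rho>[OF R] \<rho>[OF R']])
  next
    fix c R assume R: "R \<in> alg_tensor M N"
    show "\<rho> (op_scale c R) = op_scale c (\<rho> R)"
      by (rule \<rho>_eq) (rule graph_scale[OF \<rho>[OF R]])
  next
    fix R assume R: "R \<in> alg_tensor M N"
    show "\<rho> (adj R) = adj (\<rho> R)"
      by (rule \<rho>_eq) (rule graph_adj[OF \<rho>[OF R]])
  qed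
qed

end

section \<open>Classical correlations are realised by diagonal operators\<close>

lemma subalgebra_generated:
  assumes "G \<subseteq> bop"
  shows "subalgebra (generated_algebra G)"
proof -
  have "generated_algebra G \<subseteq> bop"
    using subalgebra_bop assms by (auto simp: generated_algebra_def)
  then show ?thesis unfolding subalgebra_def[of "generated_algebra G"]
    by (auto simp: generated_algebra_def subalgebraD)
qed

lemma generated_algebra_least: "subalgebra M \<Longrightarrow> G \<subseteq> M \<Longrightarrow> generated_algebra G \<subseteq> M"
  by (auto simp: generated_algebra_def)

lemma generated_algebra_extends: "G \<subseteq> generated_algebra G"
  by (auto simp: generated_algebra_def)

lemma adj_generated_algebra:
  assumes G: "G \<subseteq> bop" "\<And>T. T \<in> G \<Longrightarrow> adj T \<in> G" and T: "T \<in> generated_algebra G"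
  shows "adj T \<in> generated_algebra G"
proof -
  note sub = subalgebraD[OF subalgebra_generated[OF G(1)]]
  have "subalgebra {T \<in> generated_algebra G. adj T \<in> generated_algebra G}"
    unfolding subalgebra_def by (auto simp: sub adj_zero adj_add adj_compose adj_scale)
  moreover have "G \<subseteq> {T \<in> generated_algebra G. adj T \<in> generated_algebra G}"
    using generated_algebra_extends[of G] G(2) by auto
  ultimately show ?thesis using generated_algebra_least T by blast
qed

lemma generated_cstar_algebraD:
  assumes M: "M = generated_cstar_algebra G"
  shows "T \<in> G \<Longrightarrow> T \<in> M" "0 \<in> M" "id_blinfun \<in> M" "S \<in> M \<Longrightarrow> T \<in> M \<Longrightarrow> S + T \<in> M"
    "S \<in> M \<Longrightarrow> T \<in> M \<Longrightarrow> S o\<^sub>L T \<in> M" "T \<in> M \<Longrightarrow> op_scale c T \<in> M"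
  unfolding M generated_cstar_algebra_def by (auto simp: cstar_algebra_def subalgebraD)

lemma universal_pvm_algebraD:
  assumes "universal_pvm_algebra X A \<A> e"
  shows "x \<in> X \<Longrightarrow> a \<in> A \<Longrightarrow> projection (e x a)" "x \<in> X \<Longrightarrow> (\<Sum>a\<in>A. e x a) = id_blinfun"
    "\<A> = generated_cstar_algebra (generators X A e)" "x \<in> X \<Longrightarrow> a \<in> A \<Longrightarrow> e x a \<in> generators X A e"
  using assms by (auto simp: universal_pvm_algebra_def pvm_def generators_def)

lemma generators_adj:
  assumes "universal_pvm_algebra X A \<A> e" "T \<in> generators X A e"
  shows "T \<in> bop" "adj T = T"
  using assms universal_pvm_algebraD(1)[OF assms(1)] by (auto simp: generators_def projection_def)

text \<open>A sequence of deterministic strategies \<open>s\<close> gives diagonal projection-valued measures; the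
  homomorphism that they induce maps the algebra generated by the \<open>e x a\<close> into the diagonal
  operators.\<close>

lemma deterministic_hom_exists:
  fixes \<A> :: "'i ell2 operator set" and s :: "nat \<Rightarrow> 'x \<Rightarrow> 'a"
  assumes univ: "universal_pvm_algebra X A \<A> e" and A: "finite A"
    and s: "\<And>k x. x \<in> X \<Longrightarrow> s k x \<in> A"
  obtains \<theta> :: "'i ell2 operator \<Rightarrow> nat ell2 operator" where
    "star_hom (generated_algebra (generators X A e)) diagonal \<theta>"
    "\<And>x a. x \<in> X \<Longrightarrow> a \<in> A \<Longrightarrow> diagonal_with (\<lambda>k. of_bool (s k x = a)) (\<theta> (e x a))"
proof -
  let ?gen = "generated_algebra (generators X A e)"
  have "\<exists>D. diagonal_with (\<lambda>k. of_bool (s k x = a)) D" for x a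
    using diagonal_with_exists[of "\<lambda>k. of_bool (s k x = a)"] by fastforce
  then obtain D where D: "\<And>x a. diagonal_with (\<lambda>k. of_bool (s k x = a)) (D x a)" by metis
  have "projection (D x a)" for x a
  proof -
    have "diagonal_with (\<lambda>k. of_bool (s k x = a)) (adj (D x a))"
      using diagonal_with_adj[OF D[of x a]] by (simp add: of_bool_def if_distrib cong: if_cong)
    moreover have "diagonal_with (\<lambda>k. of_bool (s k x = a)) (D x a o\<^sub>L D x a)"
      using diagonal_with_compose[OF D[of x a] D[of x a]]
      by (simp add: of_bool_conj[symmetric] del: of_bool_conj)
    ultimately show ?thesis
      unfolding projection_def using D diagonal_with_unique diagonal_with_in_bop by blast
  qed
  moreover have "(\<Sum>a\<in>A. D x a) = id_blinfun" if x: "x \<in> X" for x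
  proof (intro blinfun_eqI ell2_eqI)
    fix v k
    have "coord (blinfun_apply (\<Sum>a\<in>A. D x a) v) k = (\<Sum>a\<in>A. of_bool (s k x = a) * coord v k)"
      by (simp add: blinfun.sum_left coord_sum diagonal_withD[OF D])
    also have "\<dots> = (\<Sum>a\<in>A. if s k x = a then coord v k else 0)"
      by (rule sum.cong) auto
    also have "\<dots> = coord v k"
      using s[OF x] A by simp
    finally show "coord (blinfun_apply (\<Sum>a\<in>A. D x a) v) k = coord (blinfun_apply id_blinfun v) k"
      by simp
  qed
  ultimately have "\<forall>x\<in>X. pvm A id_blinfun (D x)" by (simp add: pvm_def)
  then obtain \<theta> where \<theta>: "star_hom \<A> bop \<theta>" "\<And>x a. x \<in> X \<Longrightarrow> a \<in> A \<Longrightarrow> \<theta> (e x a) = D x a"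
    using univ unfolding universal_pvm_algebra_def by blast
  note inA = generated_cstar_algebraD[OF universal_pvm_algebraD(3)[OF univ]]
  note inD = subalgebraD[OF subalgebra_diagonal]
  have hom: "\<theta> id_blinfun = id_blinfun"
    "S \<in> \<A> \<Longrightarrow> T \<in> \<A> \<Longrightarrow> \<theta> (S + T) = \<theta> S + \<theta> T" "S \<in> \<A> \<Longrightarrow> T \<in> \<A> \<Longrightarrow> \<theta> (S o\<^sub>L T) = \<theta> S o\<^sub>L \<theta> T"
    "T \<in> \<A> \<Longrightarrow> \<theta> (op_scale c T) = op_scale c (\<theta> T)" "T \<in> \<A> \<Longrightarrow> \<theta> (adj T) = adj (\<theta> T)" for S T c
    using \<theta>(1) by (auto simp: star_hom_def)
  have "\<theta> 0 = 0" using hom(2)[of 0 0] inA(2) by simp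
  then have "subalgebra {T \<in> \<A> \<inter> bop. \<theta> T \<in> diagonal}"
    unfolding subalgebra_def
    by (auto simp: inA inD hom bop_zero bop_add bop_compose bop_scale)
  moreover have "generators X A e \<subseteq> {T \<in> \<A> \<inter> bop. \<theta> T \<in> diagonal}"
    using inA(1) generators_adj(1)[OF univ] \<theta>(2) diagonal_with_in_diagonal[OF D]
    by (auto simp: generators_def)
  ultimately have "?gen \<subseteq> {T \<in> \<A> \<inter> bop. \<theta> T \<in> diagonal}"
    by (rule generated_algebra_least)
  then have gen: "\<And>T. T \<in> ?gen \<Longrightarrow> T \<in> \<A>" "\<And>T. T \<in> ?gen \<Longrightarrow> \<theta> T \<in> diagonal" by auto
  show thesis
  proof (rule that)
    show "star_hom ?gen diagonal \<theta>"
      unfolding star_hom_def by (auto simp: hom gen)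
    show "diagonal_with (\<lambda>k. of_bool (s k x = a)) (\<theta> (e x a))" if "x \<in> X" "a \<in> A" for x a
      using D \<theta>(2)[OF that] by simp
  qed
qed

text \<open>The \<open>k\<close>-th diagonal entry of \<open>\<rho> (e x a \<otimes>\<^sub>o f y b)\<close> tells whether the \<open>k\<close>-th pair of
  strategies answers \<open>(a, b)\<close> to \<open>(x, y)\<close>.\<close>

lemma classical_correlation_realised:
  fixes \<A> :: "'i ell2 operator set" and \<B> :: "'j ell2 operator set"
    and s :: "nat \<Rightarrow> 'x \<Rightarrow> 'a" and t :: "nat \<Rightarrow> 'y \<Rightarrow> 'b"
  assumes univA: "universal_pvm_algebra X A \<A> e" and univB: "universal_pvm_algebra Y B \<B> f"
    and fin: "finite A" "finite B" and ne: "X \<noteq> {}" "Y \<noteq> {}"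
    and s: "\<And>k x. x \<in> X \<Longrightarrow> s k x \<in> A" and t: "\<And>k y. y \<in> Y \<Longrightarrow> t k y \<in> B"
    and w: "\<And>k. k < N \<Longrightarrow> 0 \<le> w k" "(\<Sum>k<N. w k) = 1"
  shows "\<exists>(U :: nat ell2 operator set) \<rho> \<tau>.
    von_neumann_algebra U \<and>
    star_hom (alg_tensor (generated_algebra (generators X A e)) (generated_algebra (generators Y B f))) U \<rho> \<and>
    amenable_tracial_state U \<tau> \<and>
    (\<forall>x\<in>X. \<forall>y\<in>Y. \<forall>a\<in>A. \<forall>b\<in>B.
      \<tau> (\<rho> (e x a \<otimes>\<^sub>o f y b)) = complex_of_real (\<Sum>k<N. if s k x = a \<and> t k y = b then w k else 0))"
proof -
  let ?M = "generated_algebra (generators X A e)" and ?N = "generated_algebra (generators Y B f)"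
  obtain \<theta> :: "'i ell2 operator \<Rightarrow> nat ell2 operator" where \<theta>: "star_hom ?M diagonal \<theta>"
    "\<And>x a. x \<in> X \<Longrightarrow> a \<in> A \<Longrightarrow> diagonal_with (\<lambda>k. of_bool (s k x = a)) (\<theta> (e x a))"
    by (rule deterministic_hom_exists[OF univA fin(1), of s]) (rule s, assumption, rule that)
  obtain \<theta>' :: "'j ell2 operator \<Rightarrow> nat ell2 operator" where \<theta>': "star_hom ?N diagonal \<theta>'"
    "\<And>y b. y \<in> Y \<Longrightarrow> b \<in> B \<Longrightarrow> diagonal_with (\<lambda>k. of_bool (t k y = b)) (\<theta>' (f y b))"
    by (rule deterministic_hom_exists[OF univB fin(2), of t]) (rule t, assumption, rule that)
  have bop: "generators X A e \<subseteq> bop" "generators Y B f \<subseteq> bop"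
    using generators_adj(1) univA univB by blast+
  have genM: "e x a \<in> ?M" if "x \<in> X" "a \<in> A" for x a
    using universal_pvm_algebraD(4)[OF univA that] generated_algebra_extends by blast
  have genN: "f y b \<in> ?N" if "y \<in> Y" "b \<in> B" for y b
    using universal_pvm_algebraD(4)[OF univB that] generated_algebra_extends by blast
  obtain x0 y0 where 0: "x0 \<in> X" "y0 \<in> Y" using ne by blast
  have id: "id_blinfun \<in> ?M" "id_blinfun \<in> ?N"
    using subalgebra_sum[OF subalgebra_generated[OF bop(1)], of A "e x0"] genM 0
      subalgebra_sum[OF subalgebra_generated[OF bop(2)], of B "f y0"] genN
    by (simp_all add: universal_pvm_algebraD(2)[OF univA] universal_pvm_algebraD(2)[OF univB])
  have adj: "adj T \<in> ?M" if "T \<in> ?M" for T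
    by (rule adj_generated_algebra[OF bop(1) _ that]) (simp add: generators_adj[OF univA])
  have adj': "adj T \<in> ?N" if "T \<in> ?N" for T
    by (rule adj_generated_algebra[OF bop(2) _ that]) (simp add: generators_adj[OF univB])
  interpret diagonal_homs ?M ?N \<theta> \<theta>'
    by standard
      (use bop id \<theta>(1) \<theta>'(1) subalgebra_generated adj adj' in auto)
  obtain \<rho> where \<rho>: "star_hom (alg_tensor ?M ?N) diagonal \<rho>"
    "\<And>S T. S \<in> ?M \<Longrightarrow> T \<in> ?N \<Longrightarrow> \<rho> (S \<otimes>\<^sub>o T) = \<theta> S o\<^sub>L \<theta>' T"
    by (rule product_hom_exists) (rule that)
  have "mixture N w (\<rho> (e x a \<otimes>\<^sub>o f y b))
      = complex_of_real (\<Sum>k<N. if s k x = a \<and> t k y = b then w k else 0)"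
    if xy: "x \<in> X" "y \<in> Y" "a \<in> A" "b \<in> B" for x y a b
  proof -
    have "mixture N w (\<rho> (e x a \<otimes>\<^sub>o f y b))
        = (\<Sum>k<N. complex_of_real (w k) * (of_bool (s k x = a) * of_bool (t k y = b)))"
      by (simp add: mixture_def \<rho>(2) genM genN xy diagonal_withD[OF \<theta>(2)] diagonal_withD[OF \<theta>'(2)] coord_ket)
    also have "\<dots> = (\<Sum>k<N. complex_of_real (if s k x = a \<and> t k y = b then w k else 0))"
      by (rule sum.cong) auto
    finally show ?thesis by simp
  qed
  then show ?thesis
    using von_neumann_algebra_diagonal \<rho>(1) mixture_amenable[OF w] by blast
qed

section \<open>Perfect correlations of imitation games\<close>

lemma alg_tensor_elementary: "S \<in> M \<Longrightarrow> T \<in> N \<Longrightarrow> S \<otimes>\<^sub>o T \<in> alg_tensor M N"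
  unfolding alg_tensor_def by (intro CollectI exI[of _ 1] exI[of _ "\<lambda>_. S"] exI[of _ "\<lambda>_. T"]) simp

lemma min_tensor_elementary: "S \<in> M \<Longrightarrow> T \<in> N \<Longrightarrow> S \<otimes>\<^sub>o T \<in> min_tensor M N"
  using alg_tensor_elementary closure_subset unfolding min_tensor_def by blast

theorem theorem2p3:
  fixes X :: "'x set" and Y :: "'y set" and A :: "'a set" and B :: "'b set"
    and \<Lambda> :: "'x \<Rightarrow> 'y \<Rightarrow> 'a \<Rightarrow> 'b \<Rightarrow> nat"
    and p :: "('x, 'y, 'a, 'b) correlation"
    and \<A> :: "'i ell2 operator set" and e :: "'x \<Rightarrow> 'a \<Rightarrow> 'i ell2 operator"
    and \<B> :: "'j ell2 operator set" and f :: "'y \<Rightarrow> 'b \<Rightarrow> 'j ell2 operator"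
    and \<phi> :: "('i \<times> 'j) ell2 operator \<Rightarrow> complex"
    and \<pi> :: "('i \<times> 'j) ell2 operator \<Rightarrow> 'h::chilbert_space operator"
    and \<psi> :: 'h
  assumes "imitation_game X Y A B \<Lambda>"
    and "card X = 2" and "card A = 2"
    and "p \<in> C_qa_game X Y A B \<Lambda>"
    and "universal_pvm_algebra X A \<A> e"
    and "universal_pvm_algebra Y B \<B> f"
    and "state (min_tensor \<A> \<B>) \<phi>"
    and "\<forall>x\<in>X. \<forall>y\<in>Y. \<forall>a\<in>A. \<forall>b\<in>B. \<phi> (e x a \<otimes>\<^sub>o f y b) = complex_of_real (p x y a b)"
    and "gns_triple (min_tensor \<A> \<B>) \<phi> \<pi> \<psi>"
    and "inj_on \<pi> ((\<lambda>S. S \<otimes>\<^sub>o id_blinfun) ` \<A>)"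
    and "inj_on \<pi> ((\<lambda>T. id_blinfun \<otimes>\<^sub>o T) ` \<B>)"
  shows "\<exists>(U :: nat ell2 operator set) \<rho> \<tau>.
    von_neumann_algebra U \<and>
    star_hom (alg_tensor (generated_algebra (generators X A e)) (generated_algebra (generators Y B f))) U \<rho> \<and>
    amenable_tracial_state U \<tau> \<and>
    (\<forall>x\<in>X. \<forall>y\<in>Y. \<forall>a\<in>A. \<forall>b\<in>B. \<tau> (\<rho> (e x a \<otimes>\<^sub>o f y b)) = complex_of_real (p x y a b))"
proof -
  note game = assms(1) and univA = assms(5) and univB = assms(6)
  have fin: "finite X" "finite Y" "finite A" "finite B"
    using game by (simp_all add: imitation_game_def nonlocal_game_def)
  have hom: "star_hom (min_tensor \<A> \<B>) bop \<pi>" and \<psi>: "norm \<psi> = 1"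
    and \<phi>: "\<And>c. c \<in> min_tensor \<A> \<B> \<Longrightarrow> \<phi> c = cinner \<psi> (blinfun_apply (\<pi> c) \<psi>)"
    using assms(9) by (auto simp: gns_triple_def)
  have \<pi>_bop: "\<pi> S \<in> bop" if "S \<in> min_tensor \<A> \<B>" for S
    using hom that by (auto simp: star_hom_def)
  have \<pi>_adj: "\<pi> (adj S) = adj (\<pi> S)" if "S \<in> min_tensor \<A> \<B>" for S
    using hom that by (simp add: star_hom_def)
  have \<pi>_id: "\<pi> id_blinfun = id_blinfun" using hom by (simp add: star_hom_def)
  have \<pi>_add: "\<pi> (S + T) = \<pi> S + \<pi> T" if "S \<in> min_tensor \<A> \<B>" "T \<in> min_tensor \<A> \<B>" for S T
    using hom that by (simp add: star_hom_def)
  have \<pi>_comp: "\<pi> (S o\<^sub>L T) = \<pi> S o\<^sub>L \<pi> T" if "S \<in> min_tensor \<A> \<B>" "T \<in> min_tensor \<A> \<B>" for S T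
    using hom that by (simp add: star_hom_def)
  note inA = generated_cstar_algebraD[OF universal_pvm_algebraD(3)[OF univA]]
  note inB = generated_cstar_algebraD[OF universal_pvm_algebraD(3)[OF univB]]
  have e: "e x a \<in> \<A>" "e x a \<in> bop" "adj (e x a) = e x a" "e x a o\<^sub>L e x a = e x a"
    if "x \<in> X" "a \<in> A" for x a
    using inA(1)[OF universal_pvm_algebraD(4)[OF univA that]] universal_pvm_algebraD(1)[OF univA that]
    by (simp_all add: projection_def)
  have f: "f y b \<in> \<B>" "f y b \<in> bop" "adj (f y b) = f y b" "f y b o\<^sub>L f y b = f y b"
    if "y \<in> Y" "b \<in> B" for y b
    using inB(1)[OF universal_pvm_algebraD(4)[OF univB that]] universal_pvm_algebraD(1)[OF univB that]
    by (simp_all add: projection_def)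
  define P where "P x a = blinfun_apply (\<pi> (e x a \<otimes>\<^sub>o id_blinfun))" for x a
  define Q where "Q y b = blinfun_apply (\<pi> (id_blinfun \<otimes>\<^sub>o f y b))" for y b
  note T = min_tensor_elementary
  have sym: "inner (blinfun_apply (\<pi> S) u) v = inner u (blinfun_apply (\<pi> S) v)"
    if S: "S \<in> min_tensor \<A> \<B>" "adj S = S" for S u v
    using cinner_adj_left[OF \<pi>_bop[OF S(1)], of u v] \<pi>_adj[OF S(1)] S(2)
    by (simp add: Re_cinner[symmetric])
  have PQ: "P x a (Q y b u) = blinfun_apply (\<pi> (e x a \<otimes>\<^sub>o f y b)) u"
    "Q y b (P x a u) = blinfun_apply (\<pi> (e x a \<otimes>\<^sub>o f y b)) u"
    if xy: "x \<in> X" "a \<in> A" "y \<in> Y" "b \<in> B" for x a y b u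
  proof -
    have "\<pi> (e x a \<otimes>\<^sub>o f y b) = \<pi> (e x a \<otimes>\<^sub>o id_blinfun) o\<^sub>L \<pi> (id_blinfun \<otimes>\<^sub>o f y b)"
      "\<pi> (e x a \<otimes>\<^sub>o f y b) = \<pi> (id_blinfun \<otimes>\<^sub>o f y b) o\<^sub>L \<pi> (e x a \<otimes>\<^sub>o id_blinfun)"
      using xy by (simp_all add: \<pi>_comp[symmetric] T e f inA inB tensor_op_compose bop_id)
    then show "P x a (Q y b u) = blinfun_apply (\<pi> (e x a \<otimes>\<^sub>o f y b)) u"
      "Q y b (P x a u) = blinfun_apply (\<pi> (e x a \<otimes>\<^sub>o f y b)) u"
      unfolding P_def Q_def by (metis blinfun_apply_blinfun_compose)+
  qed
  have P_sum: "(\<Sum>a\<in>A. P x a u) = u" if x: "x \<in> X" for x u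
  proof -
    have "(\<Sum>a\<in>F. e x a) \<in> \<A> \<inter> bop \<and>
        (\<Sum>a\<in>F. P x a u) = blinfun_apply (\<pi> ((\<Sum>a\<in>F. e x a) \<otimes>\<^sub>o id_blinfun)) u"
      if "finite F" "F \<subseteq> A" for F
      using that
    proof (induction F rule: finite_induct)
      case empty
      have "\<pi> 0 = 0" using \<pi>_add[of 0 0] T[OF inA(2) inB(3)] by (simp add: tensor_op_zero_left bop_id)
      then show ?case by (simp add: inA bop_zero bop_id tensor_op_zero_left)
    next
      case (insert a F)
      then show ?case
        by (simp add: inA e x bop_add bop_id tensor_op_add_left \<pi>_add T inB blinfun.add_left P_def)
    qed
    from this[of A] fin show ?thesis
      by (simp add: universal_pvm_algebraD(2)[OF univA x] tensor_op_id \<pi>_id)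
  qed
  have Q_sum: "(\<Sum>b\<in>B. Q y b u) = u" if y: "y \<in> Y" for y u
  proof -
    have "(\<Sum>b\<in>F. f y b) \<in> \<B> \<inter> bop \<and>
        (\<Sum>b\<in>F. Q y b u) = blinfun_apply (\<pi> (id_blinfun \<otimes>\<^sub>o (\<Sum>b\<in>F. f y b))) u"
      if "finite F" "F \<subseteq> B" for F
      using that
    proof (induction F rule: finite_induct)
      case empty
      have "\<pi> 0 = 0" using \<pi>_add[of 0 0] T[OF inA(2) inB(3)] by (simp add: tensor_op_zero_left bop_id)
      then show ?case by (simp add: inB bop_zero bop_id tensor_op_zero_right)
    next
      case (insert b F)
      then show ?case
        by (simp add: inB f y bop_add bop_id tensor_op_add_right \<pi>_add T inA blinfun.add_left Q_def)
    qed
    from this[of B] fin show ?thesis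
      by (simp add: universal_pvm_algebraD(2)[OF univB y] tensor_op_id \<pi>_id)
  qed
  have p: "p x y a b = inner \<psi> (P x a (Q y b \<psi>))" if xy: "x \<in> X" "y \<in> Y" "a \<in> A" "b \<in> B" for x y a b
  proof -
    have "complex_of_real (p x y a b) = cinner \<psi> (P x a (Q y b \<psi>))"
      using assms(8) xy \<phi>[OF T] by (simp add: PQ e f)
    then show ?thesis by (metis Re_cinner Re_complex_of_real)
  qed
  have P_sym: "inner (P x a u) v = inner u (P x a v)" if "x \<in> X" "a \<in> A" for x a u v
    unfolding P_def using that
    by (intro sym) (simp_all add: T e inB adj_tensor_op bop_id adj_id)
  have Q_sym: "inner (Q y b u) v = inner u (Q y b v)" if "y \<in> Y" "b \<in> B" for y b u v
    unfolding Q_def using that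
    by (intro sym) (simp_all add: T f inA adj_tensor_op bop_id adj_id)
  have P_idem: "P x a (P x a u) = P x a u" if "x \<in> X" "a \<in> A" for x a u
  proof -
    have "\<pi> (e x a \<otimes>\<^sub>o id_blinfun) o\<^sub>L \<pi> (e x a \<otimes>\<^sub>o id_blinfun) = \<pi> (e x a \<otimes>\<^sub>o id_blinfun)"
      using that by (simp add: \<pi>_comp[symmetric] T e inB tensor_op_compose bop_id)
    then show ?thesis unfolding P_def by (metis blinfun_apply_blinfun_compose)
  qed
  have Q_idem: "Q y b (Q y b u) = Q y b u" if "y \<in> Y" "b \<in> B" for y b u
  proof -
    have "\<pi> (id_blinfun \<otimes>\<^sub>o f y b) o\<^sub>L \<pi> (id_blinfun \<otimes>\<^sub>o f y b) = \<pi> (id_blinfun \<otimes>\<^sub>o f y b)"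
      using that by (simp add: \<pi>_comp[symmetric] T f inA tensor_op_compose bop_id)
    then show ?thesis unfolding Q_def by (metis blinfun_apply_blinfun_compose)
  qed
  have perfect: "P x a (Q y b \<psi>) = 0"
    if xy: "x \<in> X" "y \<in> Y" "a \<in> A" "b \<in> B" and "\<Lambda> x y a b = 0" for x y a b
  proof -
    have "p x y a b = 0"
      using assms(4) that by (simp add: C_qa_game_def C_ns_game_def perfect_def)
    moreover have "(norm (P x a (Q y b \<psi>)))\<^sup>2 = inner \<psi> (P x a (Q y b \<psi>))"
    proof -
      have "inner (P x a (Q y b \<psi>)) (P x a (Q y b \<psi>)) = inner \<psi> (Q y b (P x a (P x a (Q y b \<psi>))))"
        using xy by (simp only: P_sym Q_sym)
      also have "Q y b (P x a (P x a (Q y b \<psi>))) = P x a (Q y b (Q y b \<psi>))"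
        using xy PQ(1)[OF xy(1,3,2,4), of "Q y b \<psi>"] PQ(2)[OF xy(1,3,2,4), of "Q y b \<psi>"]
        by (simp only: P_idem)
      finally show ?thesis using xy by (simp add: power2_norm_eq_inner Q_idem)
    qed
    ultimately show ?thesis using p xy by simp
  qed
  have linear: "linear (P x a)" for x a
    unfolding P_def by (intro bounded_linear.linear blinfun.bounded_linear_right)
  have PQ_commute: "P x a (Q y b u) = Q y b (P x a u)"
    if "x \<in> X" "y \<in> Y" "a \<in> A" "b \<in> B" for x a y b u
    using PQ[OF that(1,3,2,4)] by simp
  interpret imitation_strategy X Y A B \<Lambda> P Q \<psi>
    by (rule imitation_strategy.intro; (rule assms(1,3) linear P_sym Q_sym P_idem Q_idem P_sum Q_sum
          PQ_commute \<psi> perfect; assumption))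
  obtain x1 x2 where X: "X = {x1, x2}" "x1 \<noteq> x2" using assms(2) by (meson card_2_iff)
  have x: "x1 \<in> X" "x2 \<in> X" using X by auto
  obtain g where g: "\<And>y. y \<in> Y \<Longrightarrow> classical_response x1 x2 y (g y)"
    using classical_response_exists[OF X(1)] by metis
  define q where "q c d = inner (P x1 c \<psi>) (P x2 d \<psi>)" for c d
  have q_nonneg: "0 \<le> q c d" if "c \<in> A" "d \<in> A" for c d
    using norm_P_P[OF x that] zero_le_power2 by (metis q_def)
  have q_sum: "(\<Sum>cd\<in>A \<times> A. q (fst cd) (snd cd)) = 1"
  proof -
    have "(\<Sum>c\<in>A. \<Sum>d\<in>A. q c d) = inner \<psi> \<psi>"
      by (simp add: q_def inner_sum_right[symmetric] inner_sum_left[symmetric] P_sum x)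
    then show ?thesis
      using \<psi> by (simp add: sum.cartesian_product case_prod_unfold flip: power2_norm_eq_inner)
  qed
  obtain N :: nat and h where h: "bij_betw h {..<N} (A \<times> A)"
    using ex_bij_betw_nat_finite[of "A \<times> A"] fin by (auto simp: atLeast0LessThan)
  have sum_h: "(\<Sum>k<N. F (h k)) = (\<Sum>cd\<in>A \<times> A. F cd)" for F :: "'a \<times> 'a \<Rightarrow> real"
    by (rule sum.reindex_bij_betw[OF h])
  have "A \<noteq> {}" using assms(3) by auto
  then obtain a0 where a0: "a0 \<in> A" by blast
  \<comment> \<open>Indices beyond the support of the weights need some strategy, too.\<close>
  define h' where "h' k = (if k < N then h k else (a0, a0))" for k
  have h': "h' k \<in> A \<times> A" for k
    using h a0 by (auto simp: h'_def bij_betw_def)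
  define s where "s k x = (if x = x1 then fst (h' k) else snd (h' k))" for k x
  define t where "t k y = g y (fst (h' k)) (snd (h' k))" for k y
  define w where "w k = q (fst (h' k)) (snd (h' k))" for k
  have Y: "Y \<noteq> {}"
  proof -
    obtain a' where "a' \<in> A" "a' \<noteq> a0" using other_answer[OF a0] by metis
    then show ?thesis using separated_answers_Alice[OF x(1) a0] by blast
  qed
  have p_eq: "(\<Sum>k<N. if s k x = a \<and> t k y = b then w k else 0) = p x y a b"
    if xy: "x \<in> X" "y \<in> Y" "a \<in> A" "b \<in> B" for x y a b
  proof -
    have "(\<Sum>k<N. if s k x = a \<and> t k y = b then w k else 0)
        = (\<Sum>k<N. (\<lambda>(c, d). if (if x = x1 then c else d) = a \<and> g y c d = b then q c d else 0) (h k))"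
      by (rule sum.cong) (auto simp: s_def t_def w_def h'_def case_prod_unfold)
    also have "\<dots> = (\<Sum>c\<in>A. \<Sum>d\<in>A. if (if x = x1 then c else d) = a \<and> g y c d = b then q c d else 0)"
      unfolding sum_h by (simp add: sum.cartesian_product)
    also have "\<dots> = p x y a b"
    proof (cases "x = x1")
      case True
      have "(\<Sum>c\<in>A. \<Sum>d\<in>A. if c = a \<and> g y c d = b then q c d else 0)
          = (\<Sum>c\<in>A. if c = a then (\<Sum>d\<in>A. if g y c d = b then q c d else 0) else 0)"
        by (rule sum.cong) auto
      then show ?thesis
        using g[OF xy(2)] xy True fin
        by (simp add: p classical_response_def q_def cong: if_cong)
    next
      case False
      have "(\<Sum>c\<in>A. \<Sum>d\<in>A. if d = a \<and> g y c d = b then q c d else 0)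
          = (\<Sum>d\<in>A. \<Sum>c\<in>A. if d = a \<and> g y c d = b then q c d else 0)"
        by (rule sum.swap)
      also have "\<dots> = (\<Sum>d\<in>A. if d = a then (\<Sum>c\<in>A. if g y c d = b then q c d else 0) else 0)"
        by (rule sum.cong) auto
      finally show ?thesis
        using g[OF xy(2)] xy False X fin
        by (auto simp: p classical_response_def q_def cong: if_cong)
    qed
    finally show ?thesis .
  qed
  have "0 \<le> w k" for k
    using q_nonneg h'[of k] by (auto simp: w_def mem_Times_iff)
  moreover have "(\<Sum>k<N. w k) = 1"
    using sum_h[of "\<lambda>cd. q (fst cd) (snd cd)"] q_sum by (simp add: w_def h'_def)
  moreover have "s k x \<in> A" for k x
    using h'[of k] by (auto simp: s_def mem_Times_iff)
  moreover have "t k y \<in> B" if "y \<in> Y" for k y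
    using g[OF that] h'[of k] by (auto simp: t_def classical_response_def mem_Times_iff)
  ultimately have "\<exists>(U :: nat ell2 operator set) \<rho> \<tau>.
    von_neumann_algebra U \<and>
    star_hom (alg_tensor (generated_algebra (generators X A e)) (generated_algebra (generators Y B f))) U \<rho> \<and>
    amenable_tracial_state U \<tau> \<and>
    (\<forall>x\<in>X. \<forall>y\<in>Y. \<forall>a\<in>A. \<forall>b\<in>B.
      \<tau> (\<rho> (e x a \<otimes>\<^sub>o f y b)) = complex_of_real (\<Sum>k<N. if s k x = a \<and> t k y = b then w k else 0))"
    using fin X Y by (intro classical_correlation_realised[OF univA univB]) auto
  then show ?thesis by (simp add: p_eq cong: conj_cong ball_cong)
qed

end
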